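(* Let $W=(V,\mathsf{w})$ be a weighted digraph. Then $W$ is an umbrella digraph if and only if there exists a complete cocycle measure on $W$. If $W$ is an umbrella digraph and there is a vertex $x$ from which all vertices of $W$ are accessible, then the complete cocycle measures on $W$ are parameterized by (are in bijective correspondence with the points of) an open simplex of dimension $p-1$, where $p$ is the number of basic classes of $W$.
   Context: A weighted digraph is a pair $W=(V,\mathsf{w})$ with $V$ a nonempty finite set of vertices and $\mathsf{w}:V\times V\to\mathbb{R}_{\ge0}$; its edges are the pairs $(x,y)$ with $\mathsf{w}(x,y)>0$. Its adjacency matrix $F$ is given by $[F]_{x,y}=\mathsf{w}(x,y)$, and $\rho(W)$ is the spectral radius of $F$. A finite path is a sequence $u=(x_0,\dots,x_k)$ of vertices such that each $(x_i,x_{i+1})$ is an edge; its length is $\ell(u)=k$, its final vertex is $\kappa(u)=x_k$, and its weight is $\mathsf{w}(u)=\prod_{i<k}\mathsf{w}(x_i,x_{i+1})$ (equal to $1$ if $k=0$). $O_x$ is the set of finite paths starting at $x$, and $\Omega_x$ the space of infinite paths $(x_i)_{i\ge0}$ with $x_0=x$ and all $(x_i,x_{i+1})$ edges, with the product topology and Borel $\sigma$-algebra. For $u\in O_x$, $\uparrow u\subseteq\Omega_x$ is the set of infinite paths having $u$ as a prefix. For vertices $x,y$, $x\Rightarrow y$ ($y$ is accessible from $x$) means that there is a finite path (possibly of length $0$) from $x$ to $y$. The access classes are the equivalence classes of "$x\Rightarrow y$ and $y\Rightarrow x$", partially ordered by the induced relation $\Rightarrow$. The spectral radius of an access class $D$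 is that of the block of $F$ indexed by $D$. A class is basic if its spectral radius is $\rho(W)$, and final if it has access to no other class. $W$ is an umbrella digraph if $\rho(W)>0$ and its basic access classes coincide with its final access classes. A cocycle is a function $\Gamma:\{(x,y)\in V\times V: x\Rightarrow y\}\to\mathbb{R}_{\ge0}$ such that $\Gamma(x,z)=\Gamma(x,y)\Gamma(y,z)$ whenever $x\Rightarrow y\Rightarrow z$. A cocycle measure on $W$ is a family $\mu=(\mu_x)_{x\in V}$, where $\mu_x$ is a probability measure on $\Omega_x$, such that for some real $\rho>0$ and some cocycle $\Gamma$ one has $\mu_x(\uparrow u)=\rho^{-\ell(u)}\mathsf{w}(u)\Gamma(x,\kappa(u))$ for all $x\in V$ and $u\in O_x$. It is a complete cocycle measure if $\Gamma$ is positive on all of $\{(x,y): x\Rightarrow y\}$. *)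

theory Defs
  imports
    "HOL-Probability.Probability"
    "HOL-Homology.Simplices"
    "Jordan_Normal_Form.Spectral_Radius"
begin

text \<open>The vertex set of a weighted digraph is a finite type \<open>'v\<close>; the digraph itself is its
  weight function.\<close>

definition weighted_digraph :: "('v::finite \<Rightarrow> 'v \<Rightarrow> real) \<Rightarrow> bool" where
  "weighted_digraph w \<longleftrightarrow> (\<forall>x y. 0 \<le> w x y)"

definition edge :: "('v::finite \<Rightarrow> 'v \<Rightarrow> real) \<Rightarrow> 'v \<Rightarrow> 'v \<Rightarrow> bool" where
  "edge w x y \<longleftrightarrow> 0 < w x y"

subsection \<open>Finite and infinite paths\<close>

text \<open>A finite path \<open>(x\<^sub>0, \<dots>, x\<^sub>k)\<close> is the list of its \<open>k + 1\<close> vertices; its length as a path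
  is \<open>k\<close>, one less than the length of the list, and its final vertex is \<open>last u\<close>.\<close>

definition finite_paths :: "('v::finite \<Rightarrow> 'v \<Rightarrow> real) \<Rightarrow> 'v \<Rightarrow> 'v list set" where
  "finite_paths w x = {u. u \<noteq> [] \<and> hd u = x \<and> successively (edge w) u}"

definition path_length :: "'v list \<Rightarrow> nat" where
  "path_length u = length u - 1"

definition path_weight :: "('v::finite \<Rightarrow> 'v \<Rightarrow> real) \<Rightarrow> 'v list \<Rightarrow> real" where
  "path_weight w u = (\<Prod>i<path_length u. w (u ! i) (u ! Suc i))"

definition infinite_paths :: "('v::finite \<Rightarrow> 'v \<Rightarrow> real) \<Rightarrow> 'v \<Rightarrow> (nat \<Rightarrow> 'v) set" where
  "infinite_paths w x = {\<omega>. \<omega> 0 = x \<and> (\<forall>i. edge w (\<omega> i) (\<omega> (Suc i)))}"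

definition path_topology :: "('v::finite \<Rightarrow> 'v \<Rightarrow> real) \<Rightarrow> 'v \<Rightarrow> (nat \<Rightarrow> 'v) topology" where
  "path_topology w x =
     subtopology (product_topology (\<lambda>_. discrete_topology UNIV) UNIV) (infinite_paths w x)"

text \<open>The measurable space of infinite paths; only the carrier and the \<open>\<sigma>\<close>-algebra matter
  (\<^const>\<open>sigma\<close> equips them with the null measure).\<close>

definition path_borel :: "('v::finite \<Rightarrow> 'v \<Rightarrow> real) \<Rightarrow> 'v \<Rightarrow> (nat \<Rightarrow> 'v) measure" where
  "path_borel w x = sigma (infinite_paths w x) {U. openin (path_topology w x) U}"

definition cylinder :: "('v::finite \<Rightarrow> 'v \<Rightarrow> real) \<Rightarrow> 'v \<Rightarrow> 'v list \<Rightarrow> (nat \<Rightarrow> 'v) set" where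
  "cylinder w x u = {\<omega> \<in> infinite_paths w x. \<forall>i<length u. \<omega> i = u ! i}"

subsection \<open>Access classes and umbrella digraphs\<close>

definition accessible :: "('v::finite \<Rightarrow> 'v \<Rightarrow> real) \<Rightarrow> 'v \<Rightarrow> 'v \<Rightarrow> bool" where
  "accessible w x y \<longleftrightarrow> (\<exists>u\<in>finite_paths w x. last u = y)"

definition access_classes :: "('v::finite \<Rightarrow> 'v \<Rightarrow> real) \<Rightarrow> 'v set set" where
  "access_classes w = UNIV // {(x, y). accessible w x y \<and> accessible w y x}"

definition class_accessible :: "('v::finite \<Rightarrow> 'v \<Rightarrow> real) \<Rightarrow> 'v set \<Rightarrow> 'v set \<Rightarrow> bool" where
  "class_accessible w D E \<longleftrightarrow> (\<exists>x\<in>D. \<exists>y\<in>E. accessible w x y)"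

text \<open>The block of the adjacency matrix indexed by \<open>D\<close>. Matrices of
  Jordan Normal Form are indexed by natural numbers, so the elements of \<open>D\<close> are enumerated by
  \<^term>\<open>from_nat_into D\<close>, a bijection from \<^term>\<open>{..<card D}\<close> to \<open>D\<close>. Another enumeration
  conjugates the block by a permutation matrix, which does not change its spectral radius.\<close>

definition adjacency_block :: "('v::finite \<Rightarrow> 'v \<Rightarrow> real) \<Rightarrow> 'v set \<Rightarrow> complex Matrix.mat" where
  "adjacency_block w D = Matrix.mat (card D) (card D)
     (\<lambda>(i, j). complex_of_real (w (from_nat_into D i) (from_nat_into D j)))"

definition class_radius :: "('v::finite \<Rightarrow> 'v \<Rightarrow> real) \<Rightarrow> 'v set \<Rightarrow> real" where
  "class_radius w D = spectral_radius (adjacency_block w D)"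

definition digraph_radius :: "('v::finite \<Rightarrow> 'v \<Rightarrow> real) \<Rightarrow> real" where
  "digraph_radius w = spectral_radius (adjacency_block w UNIV)"

definition basic_classes :: "('v::finite \<Rightarrow> 'v \<Rightarrow> real) \<Rightarrow> 'v set set" where
  "basic_classes w = {D \<in> access_classes w. class_radius w D = digraph_radius w}"

definition final_classes :: "('v::finite \<Rightarrow> 'v \<Rightarrow> real) \<Rightarrow> 'v set set" where
  "final_classes w =
     {D \<in> access_classes w. \<forall>E\<in>access_classes w. class_accessible w D E \<longrightarrow> E = D}"

definition umbrella_digraph :: "('v::finite \<Rightarrow> 'v \<Rightarrow> real) \<Rightarrow> bool" where
  "umbrella_digraph w \<longleftrightarrow> 0 < digraph_radius w \<and> basic_classes w = final_classes w"

subsection \<open>Cocycle measures\<close>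

text \<open>A cocycle is defined on the pairs \<open>x \<Rightarrow> y\<close> only; here it is a total function whose
  values on other pairs are irrelevant.\<close>

definition cocycle :: "('v::finite \<Rightarrow> 'v \<Rightarrow> real) \<Rightarrow> ('v \<Rightarrow> 'v \<Rightarrow> real) \<Rightarrow> bool" where
  "cocycle w \<Gamma> \<longleftrightarrow>
     (\<forall>x y. accessible w x y \<longrightarrow> 0 \<le> \<Gamma> x y) \<and>
     (\<forall>x y z. accessible w x y \<and> accessible w y z \<longrightarrow> \<Gamma> x z = \<Gamma> x y * \<Gamma> y z)"

definition path_probability_family ::
  "('v::finite \<Rightarrow> 'v \<Rightarrow> real) \<Rightarrow> ('v \<Rightarrow> (nat \<Rightarrow> 'v) measure) \<Rightarrow> bool" where
  "path_probability_family w \<mu> \<longleftrightarrow>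
     (\<forall>x. prob_space (\<mu> x) \<and> sets (\<mu> x) = sets (path_borel w x))"

definition cocycle_measure_for ::
  "('v::finite \<Rightarrow> 'v \<Rightarrow> real) \<Rightarrow> real \<Rightarrow> ('v \<Rightarrow> 'v \<Rightarrow> real) \<Rightarrow> ('v \<Rightarrow> (nat \<Rightarrow> 'v) measure) \<Rightarrow> bool" where
  "cocycle_measure_for w \<rho> \<Gamma> \<mu> \<longleftrightarrow>
     path_probability_family w \<mu> \<and> 0 < \<rho> \<and> cocycle w \<Gamma> \<and>
     (\<forall>x. \<forall>u\<in>finite_paths w x.
        measure (\<mu> x) (cylinder w x u) =
          inverse (\<rho> ^ path_length u) * path_weight w u * \<Gamma> x (last u))"

definition complete_cocycle_measure ::
  "('v::finite \<Rightarrow> 'v \<Rightarrow> real) \<Rightarrow> ('v \<Rightarrow> (nat \<Rightarrow> 'v) measure) \<Rightarrow> bool" where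
  "complete_cocycle_measure w \<mu> \<longleftrightarrow>
     (\<exists>\<rho> \<Gamma>. cocycle_measure_for w \<rho> \<Gamma> \<mu> \<and> (\<forall>x y. accessible w x y \<longrightarrow> 0 < \<Gamma> x y))"

subsection \<open>Open simplices\<close>

text \<open>The relative interior of the standard simplex of dimension \<open>n\<close>, which has \<open>n + 1\<close>
  barycentric coordinates.\<close>

definition open_standard_simplex :: "nat \<Rightarrow> (nat \<Rightarrow> real) set" where
  "open_standard_simplex n = {t \<in> standard_simplex n. \<forall>i\<le>n. 0 < t i}"

end

(* Write F for the adjacency matrix and r for its spectral radius. A complete cocycle with parameter
   rho restricts, on the vertices accessible from x, to a positive eigenfunction y |-> Gamma(x, y)
   of F for rho, since the cylinders of the paths (z, y) partition the path space of z. Comparing it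
   with the Perron vector of a class shows that the radius of the class is at most rho, with
   equality exactly for the classes that no edge leaves: hence rho = r and W is an umbrella digraph.

   Conversely, if the basic classes are the final ones, r exceeds the radius of every other class, so
   r - F is invertible with nonnegative inverse on the transient vertices: the Perron vectors of the
   final classes extend to a positive eigenfunction h, and the Markov chain with transition
   probabilities w(x, y) h(y) / (r h(x)) has the path measures with Gamma(x, y) = h(y) / h(x). If all
   vertices are accessible from x0, complete cocycle measures thus correspond to the positive
   eigenfunctions h with h(x0) = 1; these are the convex combinations with positive coefficients of
   the normalised eigenfunctions that vanish on all final classes but one. *)

theory Submission
  imports Defs
begin

section \<open>Nonnegative matrices on the access classes\<close>

text \<open>The spectral radius speaks of complex eigenvalues, everything else of real functions.
  Two facts connect them: the moduli of the entries of an eigenvector for an eigenvalue of largest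
  modulus form a nonzero g >= 0 with r g <= F g, and no real eigenvalue exceeds the radius. Against
  a positive v with F v <= s v such a g forces r <= s. So radii are computed by exhibiting
  functions, and a Perron vector need only be found with some eigenvalue.

  The obstacle is that F may be reducible and then need not have a positive eigenvector. Classes are
  treated one at a time and the vertices above them by a boundary value problem: where all class
  radii are below r, the conditions g >= 0 and r g <= F g force g = 0. This one principle gives
  uniqueness, existence and nonnegativity of extensions, and it helps to show that the radius of the
  digraph is the largest class radius.

  Measures, not cocycles, are counted: a measure sees \<open>\<Gamma>\<close> only on accessible
  pairs, and if x0 reaches everything, the row of x0 determines all of these values.\<close>

definition restricted_sum :: "('v::finite \<Rightarrow> 'v \<Rightarrow> real) \<Rightarrow> 'v set \<Rightarrow> ('v \<Rightarrow> real) \<Rightarrow> 'v \<Rightarrow> real" where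
  "restricted_sum w D g x = (\<Sum>y\<in>D. w x y * g y)"

section \<open>Accessibility and access classes\<close>

lemma accessible_iff_rtranclp: "accessible w x y \<longleftrightarrow> (edge w)\<^sup>*\<^sup>* x y"
proof
  assume "accessible w x y"
  then obtain u where "u \<noteq> []" "hd u = x" "successively (edge w) u" "last u = y"
    by (auto simp: accessible_def finite_paths_def)
  then show "(edge w)\<^sup>*\<^sup>* x y"
  proof (induction u arbitrary: x)
    case (Cons a u)
    show ?case
    proof (cases u)
      case Nil
      then show ?thesis using Cons by auto
    next
      case (Cons b v)
      then have "edge w x b" "(edge w)\<^sup>*\<^sup>* b y"
        using Cons.prems Cons.IH[of b] by auto
      then show ?thesis by (rule converse_rtranclp_into_rtranclp)
    qed
  qed simp
next
  assume "(edge w)\<^sup>*\<^sup>* x y"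
  then show "accessible w x y"
  proof (induction rule: converse_rtranclp_induct)
    case base
    show ?case unfolding accessible_def finite_paths_def by (rule bexI[of _ "[y]"]) auto
  next
    case (step x z)
    then obtain u where "u \<noteq> []" "hd u = z" "successively (edge w) u" "last u = y"
      by (auto simp: accessible_def finite_paths_def)
    then show ?case unfolding accessible_def finite_paths_def
      using step by (intro bexI[of _ "x # u"]) (auto simp: successively_Cons)
  qed
qed

lemma accessible_refl [simp]: "accessible w x x"
  by (simp add: accessible_iff_rtranclp)

lemma accessible_trans: "accessible w x y \<Longrightarrow> accessible w y z \<Longrightarrow> accessible w x z"
  by (simp add: accessible_iff_rtranclp)

lemma edge_accessible: "edge w x y \<Longrightarrow> accessible w x y"
  by (simp add: accessible_iff_rtranclp)

definition access_class_of :: "('v::finite \<Rightarrow> 'v \<Rightarrow> real) \<Rightarrow> 'v \<Rightarrow> 'v set" where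
  "access_class_of w x = {y. accessible w x y \<and> accessible w y x}"

lemma access_classes_eq: "access_classes w = range (access_class_of w)"
  unfolding access_classes_def access_class_of_def quotient_def by auto

lemma access_class_of_mem [simp]: "x \<in> access_class_of w x"
  by (simp add: access_class_of_def)

lemma access_class_of_eqI: "D \<in> access_classes w \<Longrightarrow> x \<in> D \<Longrightarrow> D = access_class_of w x"
  unfolding access_classes_eq access_class_of_def by (auto intro: accessible_trans)

lemma access_class_of_mem_classes [simp]: "access_class_of w x \<in> access_classes w"
  by (simp add: access_classes_eq)

lemma access_class_nonempty: "D \<in> access_classes w \<Longrightarrow> D \<noteq> {}"
  by (auto simp: access_classes_eq) (metis access_class_of_mem empty_iff)

lemma access_class_accessible: "D \<in> access_classes w \<Longrightarrow> x \<in> D \<Longrightarrow> y \<in> D \<Longrightarrow> accessible w x y"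
  using access_class_of_eqI by (fastforce simp: access_class_of_def)

lemma access_class_between:
  assumes "D \<in> access_classes w" "x \<in> D" "y \<in> D" "accessible w x z" "accessible w z y"
  shows "z \<in> D"
proof -
  have "accessible w z x" using assms access_class_accessible accessible_trans by metis
  then show ?thesis using assms access_class_of_eqI[of D w x] by (auto simp: access_class_of_def)
qed

text \<open>A path joining two vertices of a class never leaves it, so an invariant of the edges
  inside D spreads over D. This is the form in which irreducibility of a block enters the
  Perron-Frobenius arguments.\<close>

lemma access_class_closed:
  assumes "D \<in> access_classes w" "x \<in> D" "y \<in> D" "x \<in> S"
    and step: "\<And>a b. a \<in> S \<Longrightarrow> a \<in> D \<Longrightarrow> b \<in> D \<Longrightarrow> edge w a b \<Longrightarrow> b \<in> S"
  shows "y \<in> S"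
proof -
  have "(edge w)\<^sup>*\<^sup>* x y" using access_class_accessible[OF assms(1-3)]
    by (simp add: accessible_iff_rtranclp)
  then have "y \<in> D \<longrightarrow> y \<in> S"
  proof (induction rule: rtranclp_induct)
    case base
    then show ?case using assms by simp
  next
    case (step b c)
    show ?case
    proof
      assume "c \<in> D"
      moreover have "accessible w x b" "accessible w b c"
        using step by (simp_all add: accessible_iff_rtranclp)
      ultimately have "b \<in> D" using access_class_between[OF assms(1,2)] by blast
      then show "c \<in> S" using step \<open>c \<in> D\<close> assms(5) by blast
    qed
  qed
  then show ?thesis using assms by simp
qed

section \<open>Perron vectors and spectral radii of classes\<close>

lemma dominating_multiple:
  fixes v g :: "'v::finite \<Rightarrow> real"
  assumes v: "\<And>x. x \<in> D \<Longrightarrow> 0 < v x" and g: "\<And>x. x \<in> D \<Longrightarrow> 0 \<le> g x"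
    and "x0 \<in> D" "g x0 \<noteq> 0"
  obtains c x where "0 < c" "x \<in> D" "g x = c * v x" "\<And>y. y \<in> D \<Longrightarrow> g y \<le> c * v y"
proof -
  define c where "c = Max ((\<lambda>x. g x / v x) ` D)"
  have "c \<in> (\<lambda>x. g x / v x) ` D" unfolding c_def using assms by (intro Max_in) auto
  then obtain x where x: "x \<in> D" "c = g x / v x" by auto
  have le: "g y / v y \<le> c" if "y \<in> D" for y unfolding c_def using that by simp
  show ?thesis
  proof
    have "0 < g x0 / v x0" using assms v[of x0] g[of x0] by (simp add: less_le)
    then show "0 < c" using le[of x0] assms by simp
    show "x \<in> D" by fact
    show "g x = c * v x" using x v[of x] by simp
    show "g y \<le> c * v y" if "y \<in> D" for y using le[OF that] v[OF that] by (simp add: field_simps)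
  qed
qed

text \<open>Take the least multiple c v that dominates g and a vertex x where they touch. There r c
  v(x) = r g(x) <= (F g)(x) <= c (F v)(x) <= c s v(x), with F the block of D; divide by c v(x) >
  0.\<close>

lemma comparison:
  fixes w :: "'v::finite \<Rightarrow> 'v \<Rightarrow> real"
  assumes w: "weighted_digraph w"
    and v: "\<And>x. x \<in> D \<Longrightarrow> 0 < v x" and sv: "\<And>x. x \<in> D \<Longrightarrow> restricted_sum w D v x \<le> s * v x"
    and g: "\<And>x. x \<in> D \<Longrightarrow> 0 \<le> g x" and rg: "\<And>x. x \<in> D \<Longrightarrow> r * g x \<le> restricted_sum w D g x"
    and nz: "x0 \<in> D" "g x0 \<noteq> 0"
  shows "r \<le> s"
proof -
  obtain c x where c: "0 < c" "x \<in> D" "g x = c * v x" and le: "\<And>y. y \<in> D \<Longrightarrow> g y \<le> c * v y"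
    using dominating_multiple[of D v g x0, OF v g nz] by blast
  have "r * (c * v x) \<le> restricted_sum w D g x" using rg[OF c(2)] c by simp
  also have "\<dots> \<le> restricted_sum w D (\<lambda>y. c * v y) x"
    unfolding restricted_sum_def using w le
    by (intro sum_mono mult_left_mono) (auto simp: weighted_digraph_def)
  also have "\<dots> = c * restricted_sum w D v x"
    by (simp add: restricted_sum_def sum_distrib_left mult_ac)
  also have "\<dots> \<le> c * (s * v x)" using sv[OF c(2)] c(1) by simp
  finally show ?thesis using c(1) v[OF c(2)] by (simp add: mult.left_commute)
qed

text \<open>The maximum of \<open>g / v\<close> propagates along the edges inside the class.\<close>

lemma comparison_rigid:
  fixes w :: "'v::finite \<Rightarrow> 'v \<Rightarrow> real"
  assumes w: "weighted_digraph w" and D: "D \<in> access_classes w"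
    and v: "\<And>x. x \<in> D \<Longrightarrow> 0 < v x" and sv: "\<And>x. x \<in> D \<Longrightarrow> restricted_sum w D v x \<le> s * v x"
    and g: "\<And>x. x \<in> D \<Longrightarrow> 0 \<le> g x" and sg: "\<And>x. x \<in> D \<Longrightarrow> s * g x \<le> restricted_sum w D g x"
    and nz: "x0 \<in> D" "g x0 \<noteq> 0"
  obtains c where "0 < c" "\<And>x. x \<in> D \<Longrightarrow> g x = c * v x"
    "\<And>x. x \<in> D \<Longrightarrow> restricted_sum w D v x = s * v x"
proof -
  obtain c x where c: "0 < c" "x \<in> D" "g x = c * v x" and le: "\<And>y. y \<in> D \<Longrightarrow> g y \<le> c * v y"
    using dominating_multiple[of D v g x0, OF v g nz] by blast
  have eq: "restricted_sum w D (\<lambda>y. c * v y) a = restricted_sum w D g a"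
           "restricted_sum w D v a = s * v a"
    if a: "a \<in> D" "g a = c * v a" for a
  proof -
    \<comment> \<open>The four facts form a chain of inequalities from \<open>c * (s * v a)\<close>
      back to itself, so all of them are equalities.\<close>
    have 1: "c * (s * v a) \<le> restricted_sum w D g a" using sg[OF a(1)] a by (simp add: mult_ac)
    have 2: "restricted_sum w D g a \<le> restricted_sum w D (\<lambda>y. c * v y) a"
      unfolding restricted_sum_def using w le
      by (intro sum_mono mult_left_mono) (auto simp: weighted_digraph_def)
    have 3: "restricted_sum w D (\<lambda>y. c * v y) a = c * restricted_sum w D v a"
      by (simp add: restricted_sum_def sum_distrib_left mult_ac)
    have 4: "c * restricted_sum w D v a \<le> c * (s * v a)" using sv[OF a(1)] c(1) by simp
    show "restricted_sum w D (\<lambda>y. c * v y) a = restricted_sum w D g a" using 1 2 3 4 by linarith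
    have "c * restricted_sum w D v a = c * (s * v a)" using 1 2 3 4 by linarith
    then show "restricted_sum w D v a = s * v a" using c(1) by simp
  qed
  define S where "S = {a. g a = c * v a}"
  have "y \<in> S" if "y \<in> D" for y
  proof (rule access_class_closed[OF D c(2) that])
    show "x \<in> S" using c by (simp add: S_def)
    fix a b assume a: "a \<in> S" "a \<in> D" and b: "b \<in> D" "edge w a b"
    have "(\<Sum>y\<in>D. w a y * (c * v y - g y)) = 0"
      using eq(1)[of a] a by (simp add: restricted_sum_def S_def right_diff_distrib sum_subtractf)
    moreover have "0 \<le> w a y * (c * v y - g y)" if "y \<in> D" for y
      using w le[OF that] by (simp add: weighted_digraph_def)
    ultimately have "w a b * (c * v b - g b) = 0"
      using sum_nonneg_eq_0_iff[of D "\<lambda>y. w a y * (c * v y - g y)"] b by auto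
    then show "b \<in> S" using b by (simp add: S_def edge_def)
  qed
  then show thesis using that[of c] c eq(2) by (auto simp: S_def)
qed

text \<open>Brouwer's theorem, applied to the normalised map a -> a + F a on the simplex of
  nonnegative functions on D with sum 1. Adding a keeps the normalising sum \<open>T a\<close> at
  least 1 even if the block is zero, as for a single vertex without a loop; the eigenvalue of the
  block is then \<open>t - 1\<close>.\<close>

lemma perron_vector_exists:
  fixes w :: "'v::finite \<Rightarrow> 'v \<Rightarrow> real"
  assumes w: "weighted_digraph w" and D: "D \<in> access_classes w"
  obtains s v where "0 \<le> s" "\<And>x. x \<in> D \<Longrightarrow> 0 < v x"
    "\<And>x. x \<in> D \<Longrightarrow> restricted_sum w D v x = s * v x"
proof -
  define S :: "(real, 'v) Finite_Cartesian_Product.vec set" where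
    "S = {a. (\<forall>x. 0 \<le> vec_nth a x) \<and> (\<forall>x. x \<notin> D \<longrightarrow> vec_nth a x = 0) \<and> (\<Sum>x\<in>D. vec_nth a x) = 1}"
  define G where "G a x = (if x \<in> D then vec_nth a x + restricted_sum w D (vec_nth a) x else 0)"
    for a :: "(real, 'v) Finite_Cartesian_Product.vec" and x
  define T where "T a = (\<Sum>x\<in>D. G a x)" for a
  define f where "f a = (vec_lambda (\<lambda>x. G a x / T a) :: (real, 'v) Finite_Cartesian_Product.vec)" for a
  have wpos: "0 \<le> w x y" for x y using w by (simp add: weighted_digraph_def)
  have rs0: "0 \<le> restricted_sum w D (vec_nth a) x" if "a \<in> S" for a x
    unfolding restricted_sum_def using that wpos by (intro sum_nonneg) (auto simp: S_def)
  have T1: "1 \<le> T a" if "a \<in> S" for a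
  proof -
    have "(\<Sum>x\<in>D. vec_nth a x) \<le> T a" unfolding T_def G_def
      using rs0[OF that] by (intro sum_mono) auto
    then show ?thesis using that by (simp add: S_def)
  qed
  have le1: "vec_nth a x \<le> 1" if "a \<in> S" for a x
  proof (cases "x \<in> D")
    case True
    then have "vec_nth a x \<le> (\<Sum>x\<in>D. vec_nth a x)"
      using that by (intro member_le_sum) (auto simp: S_def)
    then show ?thesis using that by (simp add: S_def)
  qed (use that in \<open>auto simp: S_def\<close>)
  have "bounded S"
    unfolding bounded_iff
  proof (intro exI[of _ "real CARD('v)"] ballI)
    fix a assume "a \<in> S"
    then have "\<bar>vec_nth a x\<bar> \<le> 1" for x using le1[of a x] by (simp add: S_def)
    then have "(\<Sum>x\<in>UNIV. \<bar>vec_nth a x\<bar>) \<le> (\<Sum>x\<in>(UNIV::'v set). 1)" by (intro sum_mono) auto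
    then show "norm a \<le> real CARD('v)" using norm_le_l1_cart[of a] by simp
  qed
  moreover have "closed S"
  proof -
    have "S = (\<Inter>x. {a. 0 \<le> vec_nth a x}) \<inter> (\<Inter>x\<in>-D. {a. vec_nth a x = 0}) \<inter>
        {a. (\<Sum>x\<in>D. vec_nth a x) = 1}"
      by (auto simp: S_def)
    moreover have "closed {a :: (real, 'v) Finite_Cartesian_Product.vec. 0 \<le> vec_nth a x}" for x
      by (intro closed_Collect_le continuous_intros)
    moreover have "closed {a :: (real, 'v) Finite_Cartesian_Product.vec. vec_nth a x = 0}" for x
      by (intro closed_Collect_eq continuous_intros)
    moreover have "closed {a :: (real, 'v) Finite_Cartesian_Product.vec. (\<Sum>x\<in>D. vec_nth a x) = 1}"
      by (intro closed_Collect_eq continuous_intros)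
    ultimately show ?thesis by (auto intro!: closed_Int closed_INT)
  qed
  ultimately have "compact S" by (simp add: compact_eq_bounded_closed)
  moreover have "convex S"
  proof (rule convexI)
    fix a b :: "(real, 'v) Finite_Cartesian_Product.vec" and p q :: real
    assume "a \<in> S" "b \<in> S" "0 \<le> p" "0 \<le> q" "p + q = 1"
    then show "p *\<^sub>R a + q *\<^sub>R b \<in> S"
      by (auto simp: S_def sum.distrib sum_distrib_left[symmetric])
  qed
  moreover have "S \<noteq> {}"
  proof -
    obtain x where x: "x \<in> D" using access_class_nonempty[OF D] by blast
    have "vec_lambda (\<lambda>y. if y = x then 1 else 0) \<in> S" using x by (auto simp: S_def)
    then show ?thesis by blast
  qed
  moreover have "continuous_on S f"
  proof -
    have cG: "continuous_on S (\<lambda>a. G a x)" for x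
      unfolding G_def restricted_sum_def by (cases "x \<in> D") (auto intro!: continuous_intros)
    have "continuous_on S (\<lambda>a. T a)" unfolding T_def by (intro continuous_intros cG)
    then have "continuous_on S (\<lambda>a. G a x / T a)" for x
      using T1 by (intro continuous_on_divide cG) fastforce+
    then show ?thesis unfolding f_def by (intro continuous_on_vec_lambda)
  qed
  moreover have "f \<in> S \<rightarrow> S"
  proof
    fix a assume a: "a \<in> S"
    have "(\<Sum>x\<in>D. vec_nth (f a) x) = 1"
      using T1[OF a] by (simp add: f_def sum_divide_distrib[symmetric] T_def[symmetric])
    moreover have "0 \<le> vec_nth (f a) x" for x
      using a T1[OF a] rs0[OF a] by (auto simp: f_def G_def S_def)
    ultimately show "f a \<in> S" by (auto simp: S_def f_def G_def)
  qed
  ultimately obtain a where a: "a \<in> S" and fa: "f a = a" by (rule brouwer)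
  define t where "t = T a"
  have t1: "1 \<le> t" using T1[OF a] by (simp add: t_def)
  have eq: "restricted_sum w D (vec_nth a) x = (t - 1) * vec_nth a x" if "x \<in> D" for x
  proof -
    have "G a x / t = vec_nth a x" using arg_cong[OF fa, of "\<lambda>b. vec_nth b x"]
      by (simp add: f_def t_def)
    then show ?thesis using that t1 by (simp add: G_def field_simps)
  qed
  have a0: "0 \<le> vec_nth a x" for x using a by (simp add: S_def)
  have ex: "\<exists>x\<in>D. vec_nth a x \<noteq> 0"
  proof (rule ccontr)
    assume "\<not> ?thesis"
    then have "(\<Sum>x\<in>D. vec_nth a x) = 0" by simp
    then show False using a by (simp add: S_def)
  qed
  have "0 < vec_nth a x" if x: "x \<in> D" for x
  proof (rule ccontr)
    assume "\<not> 0 < vec_nth a x"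
    then have z: "vec_nth a x = 0" using a0[of x] by simp
    obtain y where y: "y \<in> D" "vec_nth a y \<noteq> 0" using ex by blast
    \<comment> \<open>At a zero of the eigenvector a sum of nonnegative terms vanishes, so all
      successors inside D are zeros too: one zero would spread over the class.\<close>
    have "y \<in> {x. vec_nth a x = 0}"
    proof (rule access_class_closed[OF D x y(1)])
      fix b c assume "b \<in> {x. vec_nth a x = 0}" and bc: "b \<in> D" "c \<in> D" "edge w b c"
      then have "(\<Sum>y\<in>D. w b y * vec_nth a y) = 0" using eq[of b] by (simp add: restricted_sum_def)
      then have "w b c * vec_nth a c = 0"
        using sum_nonneg_eq_0_iff[of D "\<lambda>y. w b y * vec_nth a y"] bc a0 wpos by auto
      then show "c \<in> {x. vec_nth a x = 0}" using bc by (simp add: edge_def)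
    qed (use z in simp)
    then show False using y by simp
  qed
  then show thesis using that[of "t - 1" "vec_nth a"] eq t1 by simp
qed

text \<open>Take the moduli of the entries of a complex eigenvector whose eigenvalue has modulus
  equal to the radius; the triangle inequality turns the eigenvalue equation into the inequality.
  The map \<open>idx\<close> inverts the enumeration of D, carrying entries indexed by numbers back
  to vertices.\<close>

lemma block_radius_subeigen:
  fixes w :: "'v::finite \<Rightarrow> 'v \<Rightarrow> real"
  assumes w: "weighted_digraph w" and "D \<noteq> {}"
  obtains g x0 where "\<And>x. 0 \<le> g x" "x0 \<in> D" "g x0 \<noteq> 0"
    "\<And>x. x \<in> D \<Longrightarrow> spectral_radius (adjacency_block w D) * g x \<le> restricted_sum w D g x"
proof -
  let ?A = "adjacency_block w D" and ?n = "card D"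
  have A: "?A \<in> carrier_mat ?n ?n" by (simp add: adjacency_block_def)
  have n: "?n > 0" using assms by (simp add: card_gt_0_iff)
  obtain l where l: "l \<in> spectrum ?A" "spectral_radius ?A = norm l"
    using spectral_radius_mem_max(1)[OF A n] by auto
  obtain z where z: "z \<in> carrier_vec ?n" "z \<noteq> 0\<^sub>v ?n" "?A *\<^sub>v z = l \<cdot>\<^sub>v z"
    using l(1) A by (auto simp: spectrum_def eigenvalue_def eigenvector_def)
  have bij: "bij_betw (from_nat_into D) {..<?n} D"
    by (rule bij_betw_from_nat_into_finite) simp
  define idx where "idx = the_inv_into {..<?n} (from_nat_into D)"
  have inj: "inj_on (from_nat_into D) {..<?n}" using bij by (simp add: bij_betw_def)
  have idx: "idx (from_nat_into D i) = i" if "i < ?n" for i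
    unfolding idx_def using that by (intro the_inv_into_f_f inj) auto
  define g where "g x = (if x \<in> D then norm (vec_index z (idx x)) else 0)" for x
  have fD: "from_nat_into D i \<in> D" for i using assms by (simp add: from_nat_into)
  have gi: "g (from_nat_into D i) = norm (vec_index z i)" if "i < ?n" for i
    using that idx fD by (simp add: g_def)
  have main: "norm l * g (from_nat_into D i) \<le> restricted_sum w D g (from_nat_into D i)"
    if i: "i < ?n" for i
  proof -
    have "vec_index (?A *\<^sub>v z) i = (\<Sum>j<?n. complex_of_real (w (from_nat_into D i) (from_nat_into D j)) * vec_index z j)"
      using i z(1) by (simp add: adjacency_block_def scalar_prod_def atLeast0LessThan)
    moreover have "vec_index (?A *\<^sub>v z) i = l * vec_index z i" using i z by simp
    ultimately have "norm l * norm (vec_index z i) =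
        norm (\<Sum>j<?n. complex_of_real (w (from_nat_into D i) (from_nat_into D j)) * vec_index z j)"
      by (metis norm_mult)
    also have "\<dots> \<le> (\<Sum>j<?n. w (from_nat_into D i) (from_nat_into D j) * norm (vec_index z j))"
      using w by (intro order_trans[OF norm_sum] sum_mono) (simp add: norm_mult weighted_digraph_def)
    also have "\<dots> = (\<Sum>j<?n. w (from_nat_into D i) (from_nat_into D j) * g (from_nat_into D j))"
      using gi by simp
    also have "\<dots> = restricted_sum w D g (from_nat_into D i)"
      unfolding restricted_sum_def by (rule sum.reindex_bij_betw[OF bij])
    finally show ?thesis using gi[OF i] by simp
  qed
  have "\<exists>i<?n. vec_index z i \<noteq> 0"
  proof (rule ccontr)
    assume "\<not> ?thesis"
    then have "z = 0\<^sub>v ?n" using z(1) by (intro eq_vecI) auto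
    then show False using z by simp
  qed
  then obtain i where i: "i < ?n" "vec_index z i \<noteq> 0" by blast
  show thesis
  proof (rule that[of g "from_nat_into D i"])
    show "0 \<le> g x" for x by (simp add: g_def)
    show "g (from_nat_into D i) \<noteq> 0" using gi[OF i(1)] i(2) by simp
    fix x assume "x \<in> D"
    then obtain j where "j < ?n" "x = from_nat_into D j"
      using bij by (auto simp: bij_betw_def)
    then show "spectral_radius ?A * g x \<le> restricted_sum w D g x" using main l by simp
  qed (rule fD)
qed

lemma eigenvalue_le_block_radius:
  fixes w :: "'v::finite \<Rightarrow> 'v \<Rightarrow> real"
  assumes h: "\<And>x. x \<in> D \<Longrightarrow> restricted_sum w D h x = s * h x" and x0: "x0 \<in> D" "h x0 \<noteq> 0"
  shows "\<bar>s\<bar> \<le> spectral_radius (adjacency_block w D)"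
proof -
  let ?A = "adjacency_block w D" and ?n = "card D"
  have A: "?A \<in> carrier_mat ?n ?n" by (simp add: adjacency_block_def)
  have n: "?n > 0" using assms by (auto simp: card_gt_0_iff)
  have bij: "bij_betw (from_nat_into D) {..<?n} D"
    by (rule bij_betw_from_nat_into_finite) simp
  define z where "z = Matrix.vec ?n (\<lambda>i. complex_of_real (h (from_nat_into D i)))"
  have "?A *\<^sub>v z = complex_of_real s \<cdot>\<^sub>v z"
  proof (rule eq_vecI)
    fix i assume "i < dim_vec (complex_of_real s \<cdot>\<^sub>v z)"
    then have i: "i < ?n" by (simp add: z_def)
    then have "vec_index (?A *\<^sub>v z) i = (\<Sum>j<?n. complex_of_real (w (from_nat_into D i) (from_nat_into D j)) *
        complex_of_real (h (from_nat_into D j)))"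
      by (simp add: adjacency_block_def scalar_prod_def atLeast0LessThan z_def)
    also have "\<dots> = complex_of_real (\<Sum>j<?n. w (from_nat_into D i) (from_nat_into D j) * h (from_nat_into D j))"
      by simp
    also have "(\<Sum>j<?n. w (from_nat_into D i) (from_nat_into D j) * h (from_nat_into D j)) =
        restricted_sum w D h (from_nat_into D i)"
      unfolding restricted_sum_def by (rule sum.reindex_bij_betw[OF bij])
    also have "\<dots> = s * h (from_nat_into D i)" using x0 by (intro h from_nat_into) auto
    finally show "vec_index (?A *\<^sub>v z) i = vec_index (complex_of_real s \<cdot>\<^sub>v z) i"
      using i by (simp add: z_def)
  qed (simp add: z_def adjacency_block_def)
  moreover have "z \<noteq> 0\<^sub>v ?n"
  proof
    assume "z = 0\<^sub>v ?n"
    obtain j where j: "j < ?n" "x0 = from_nat_into D j"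
      using bij x0 by (auto simp: bij_betw_def)
    have "vec_index z j = 0" using \<open>z = 0\<^sub>v ?n\<close> j by simp
    then show False using j x0 by (simp add: z_def)
  qed
  ultimately have "eigenvector ?A z (complex_of_real s)"
    using A by (simp add: eigenvector_def z_def)
  then have "complex_of_real s \<in> spectrum ?A" by (auto simp: spectrum_def eigenvalue_def)
  then have "norm (complex_of_real s) \<in> norm ` spectrum ?A" by blast
  then show ?thesis using spectral_radius_mem_max(2)[OF A n] by fastforce
qed

text \<open>The eigenvalue s of the vector found by Brouwer's theorem is at most the radius because
  it lies in the spectrum, and at least the radius by comparison with the moduli of a complex
  eigenvector.\<close>

lemma class_perron_vector:
  fixes w :: "'v::finite \<Rightarrow> 'v \<Rightarrow> real"
  assumes w: "weighted_digraph w" and D: "D \<in> access_classes w"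
  obtains v where "\<And>x. x \<in> D \<Longrightarrow> 0 < v x"
    "\<And>x. x \<in> D \<Longrightarrow> restricted_sum w D v x = class_radius w D * v x"
proof -
  obtain s v where s: "0 \<le> s" and v: "\<And>x. x \<in> D \<Longrightarrow> 0 < v x"
    and sv: "\<And>x. x \<in> D \<Longrightarrow> restricted_sum w D v x = s * v x"
    by (metis perron_vector_exists[OF w D])
  have "D \<noteq> {}" using D by (rule access_class_nonempty)
  then obtain x where x: "x \<in> D" by blast
  obtain g x0 where g: "\<And>x. 0 \<le> g x" "x0 \<in> D" "g x0 \<noteq> 0"
    "\<And>x. x \<in> D \<Longrightarrow> class_radius w D * g x \<le> restricted_sum w D g x"
    using block_radius_subeigen[OF w \<open>D \<noteq> {}\<close>, folded class_radius_def] by metis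
  have "\<bar>s\<bar> \<le> class_radius w D" unfolding class_radius_def
    using eigenvalue_le_block_radius[OF sv x] v[OF x] by simp
  moreover have "class_radius w D \<le> s"
    by (rule comparison[OF w, where v = v and g = g and D = D]) (use v sv g in auto)
  ultimately have "class_radius w D = s" by simp
  with sv have "\<And>x. x \<in> D \<Longrightarrow> restricted_sum w D v x = class_radius w D * v x" by simp
  with v show thesis by (rule that)
qed

section \<open>Maximum principle and Dirichlet problem on unions of classes\<close>

definition saturated :: "('v::finite \<Rightarrow> 'v \<Rightarrow> real) \<Rightarrow> 'v set \<Rightarrow> bool" where
  "saturated w N \<longleftrightarrow> (\<forall>x\<in>N. access_class_of w x \<subseteq> N)"

text \<open>A vertex \<open>x\<close> of the support of \<open>g\<close> that has access to as few vertices of the support as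
  possible has access only to those of its own class, so on that class the restriction of the sum
  to \<open>N\<close> may be replaced by the restriction to the class.\<close>

lemma subeigen_le_some_class_radius:
  fixes w :: "'v::finite \<Rightarrow> 'v \<Rightarrow> real"
  assumes w: "weighted_digraph w" and N: "saturated w N"
    and g: "\<And>x. x \<in> N \<Longrightarrow> 0 \<le> g x" and rg: "\<And>x. x \<in> N \<Longrightarrow> r * g x \<le> restricted_sum w N g x"
    and nz: "x0 \<in> N" "g x0 \<noteq> 0"
  obtains D where "D \<in> access_classes w" "D \<subseteq> N" "r \<le> class_radius w D"
proof -
  define S where "S = {x\<in>N. g x \<noteq> 0}"
  have "x0 \<in> S" using nz by (simp add: S_def)
  then obtain x where x: "x \<in> S" and min: "\<And>y. y \<in> S \<Longrightarrow>
      card {z\<in>S. accessible w x z} \<le> card {z\<in>S. accessible w y z}"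
    using ex_has_least_nat[of "\<lambda>x. x \<in> S" x0 "\<lambda>x. card {z\<in>S. accessible w x z}"] by blast
  have returns: "accessible w y x" if "y \<in> S" "accessible w x y" for y
  proof (rule ccontr)
    assume "\<not> accessible w y x"
    then have "{z\<in>S. accessible w y z} \<subset> {z\<in>S. accessible w x z}"
      using that x by (auto intro: accessible_trans)
    then have "card {z\<in>S. accessible w y z} < card {z\<in>S. accessible w x z}"
      by (intro psubset_card_mono) auto
    then show False using min[OF that(1)] by simp
  qed
  define D where "D = access_class_of w x"
  have D: "D \<in> access_classes w" by (simp add: D_def)
  have DN: "D \<subseteq> N" using N x by (auto simp: saturated_def D_def S_def)
  have eq: "restricted_sum w N g z = restricted_sum w D g z" if z: "z \<in> D" for z
    unfolding restricted_sum_def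
  proof (rule sum.mono_neutral_right)
    show "\<forall>y\<in>N - D. w z y * g y = 0"
    proof
      fix y assume y: "y \<in> N - D"
      show "w z y * g y = 0"
      proof (rule ccontr)
        assume "w z y * g y \<noteq> 0"
        then have "edge w z y" "y \<in> S" using w y by (auto simp: S_def edge_def weighted_digraph_def less_le)
        then have "accessible w x y" using z by (auto simp: D_def access_class_of_def intro: accessible_trans edge_accessible)
        then show False using returns \<open>y \<in> S\<close> y by (auto simp: D_def access_class_of_def)
      qed
    qed
  qed (use DN in auto)
  obtain v where v: "\<And>x. x \<in> D \<Longrightarrow> 0 < v x"
    "\<And>x. x \<in> D \<Longrightarrow> restricted_sum w D v x = class_radius w D * v x"
    using class_perron_vector[OF w D] by blast
  have "r \<le> class_radius w D"
  proof (rule comparison[OF w, where v = v and g = g and D = D])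
    show "x \<in> D" "g x \<noteq> 0" using x by (auto simp: D_def S_def)
  next
    show "r * g z \<le> restricted_sum w D g z" if "z \<in> D" for z
      using rg[of z] eq[OF that] that DN by auto
  qed (use v DN g in auto)
  then show thesis using that D DN by blast
qed

text \<open>This is the maximum principle. Applied to absolute values it yields uniqueness for the
  eigenvalue equation, applied to negative parts it yields nonnegativity of solutions.\<close>

lemma subeigen_eq_0:
  fixes w :: "'v::finite \<Rightarrow> 'v \<Rightarrow> real"
  assumes w: "weighted_digraph w" and N: "saturated w N"
    and rad: "\<And>D. D \<in> access_classes w \<Longrightarrow> D \<subseteq> N \<Longrightarrow> class_radius w D < r"
    and g: "\<And>x. x \<in> N \<Longrightarrow> 0 \<le> g x" and rg: "\<And>x. x \<in> N \<Longrightarrow> r * g x \<le> restricted_sum w N g x"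
    and x: "x \<in> N"
  shows "g x = 0"
proof (rule ccontr)
  assume "g x \<noteq> 0"
  then obtain D where "D \<in> access_classes w" "D \<subseteq> N" "r \<le> class_radius w D"
    using subeigen_le_some_class_radius[OF w N, of g r x] g rg x by blast
  then show False using rad[of D] by simp
qed

lemma eigen_eq_0:
  fixes w :: "'v::finite \<Rightarrow> 'v \<Rightarrow> real"
  assumes w: "weighted_digraph w" and N: "saturated w N" and "0 \<le> r"
    and rad: "\<And>D. D \<in> access_classes w \<Longrightarrow> D \<subseteq> N \<Longrightarrow> class_radius w D < r"
    and rg: "\<And>x. x \<in> N \<Longrightarrow> restricted_sum w N g x = r * g x"
    and x: "x \<in> N"
  shows "g x = 0"
proof -
  have "\<bar>g x\<bar> = 0"
  proof (rule subeigen_eq_0[OF w N rad, where g = "\<lambda>x. \<bar>g x\<bar>"])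
    fix x assume "x \<in> N"
    then have "r * \<bar>g x\<bar> = \<bar>restricted_sum w N g x\<bar>" using rg \<open>0 \<le> r\<close> by (simp add: abs_mult)
    also have "\<dots> \<le> restricted_sum w N (\<lambda>x. \<bar>g x\<bar>) x"
      unfolding restricted_sum_def using w
      by (intro order_trans[OF sum_abs] sum_mono) (simp add: abs_mult weighted_digraph_def)
    finally show "r * \<bar>g x\<bar> \<le> restricted_sum w N (\<lambda>x. \<bar>g x\<bar>) x" .
  qed (use x in auto)
  then show ?thesis by simp
qed

lemma restricted_sum_split:
  "restricted_sum w UNIV h x = restricted_sum w N h x + restricted_sum w (- N) h x"
  unfolding restricted_sum_def
  by (subst sum.union_disjoint[symmetric]) (auto intro: sum.cong)

text \<open>The discrete Dirichlet problem: \<open>r\<close> minus the block of \<open>N\<close> is injective, hence surjective.\<close>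

lemma dirichlet_extension:
  fixes w :: "'v::finite \<Rightarrow> 'v \<Rightarrow> real"
  assumes w: "weighted_digraph w" and N: "saturated w N" and r: "0 \<le> r"
    and rad: "\<And>D. D \<in> access_classes w \<Longrightarrow> D \<subseteq> N \<Longrightarrow> class_radius w D < r"
  obtains h where "\<And>x. x \<notin> N \<Longrightarrow> h x = b x" "\<And>x. x \<in> N \<Longrightarrow> restricted_sum w UNIV h x = r * h x"
proof -
  \<comment> \<open>Off N the map is the identity, so it is an endomorphism of the whole space. The
    prescribed values b and their contribution to the sums over N then form the right-hand side of
    one linear equation.\<close>
  define L where "L a = (vec_lambda (\<lambda>x. if x \<in> N then r * vec_nth a x - restricted_sum w N (vec_nth a) x
      else vec_nth a x) :: (real, 'v) Finite_Cartesian_Product.vec)" for a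
  have lin: "linear L"
  proof (rule linearI)
    show "L (a + b) = L a + L b" for a b
      by (simp add: L_def Finite_Cartesian_Product.vec_eq_iff restricted_sum_def sum.distrib algebra_simps)
    show "L (c *\<^sub>R a) = c *\<^sub>R L a" for c a
      by (simp add: L_def Finite_Cartesian_Product.vec_eq_iff restricted_sum_def sum_distrib_left algebra_simps)
  qed
  have "inj L"
    unfolding linear_injective_0[OF lin]
  proof (intro allI impI)
    fix a assume La: "L a = 0"
    have off: "vec_nth a x = 0" if "x \<notin> N" for x
      using arg_cong[OF La, of "\<lambda>a. vec_nth a x"] that by (simp add: L_def)
    have on: "restricted_sum w N (vec_nth a) x = r * vec_nth a x" if "x \<in> N" for x
      using arg_cong[OF La, of "\<lambda>a. vec_nth a x"] that by (simp add: L_def)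
    have "vec_nth a x = 0" for x using eigen_eq_0[OF w N r rad on] off by blast
    then show "a = 0" by (simp add: Finite_Cartesian_Product.vec_eq_iff)
  qed
  then have "surj L" by (rule linear_injective_imp_surjective[OF lin]) simp
  then obtain a where a: "L a = vec_lambda (\<lambda>x. if x \<in> N then restricted_sum w (- N) b x else b x)"
    by (metis surjD)
  have a_nth: "vec_nth (L a) x = (if x \<in> N then restricted_sum w (- N) b x else b x)" for x
    by (simp add: a)
  show thesis
  proof
    show off: "vec_nth a x = b x" if "x \<notin> N" for x using a_nth[of x] that by (simp add: L_def)
    fix x assume "x \<in> N"
    then have "r * vec_nth a x - restricted_sum w N (vec_nth a) x = restricted_sum w (- N) b x"
      using a_nth[of x] by (simp add: L_def)
    moreover have "restricted_sum w (- N) b x = restricted_sum w (- N) (vec_nth a) x"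
      unfolding restricted_sum_def using off by (intro sum.cong) auto
    ultimately show "restricted_sum w UNIV (vec_nth a) x = r * vec_nth a x"
      using restricted_sum_split[of w "vec_nth a" x N] by simp
  qed
qed

text \<open>The negative part g of h satisfies the hypotheses of the maximum principle: where h is
  negative, r g = - F h, the part of F h coming from outside N is nonnegative, and - h <= g
  everywhere.\<close>

lemma dirichlet_nonneg:
  fixes w :: "'v::finite \<Rightarrow> 'v \<Rightarrow> real"
  assumes w: "weighted_digraph w" and N: "saturated w N"
    and rad: "\<And>D. D \<in> access_classes w \<Longrightarrow> D \<subseteq> N \<Longrightarrow> class_radius w D < r"
    and off: "\<And>x. x \<notin> N \<Longrightarrow> 0 \<le> h x" and h: "\<And>x. x \<in> N \<Longrightarrow> restricted_sum w UNIV h x = r * h x"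
  shows "0 \<le> h x"
proof (cases "x \<in> N")
  case True
  have wpos: "0 \<le> w x y" for x y using w by (simp add: weighted_digraph_def)
  define g where "g x = max (- h x) 0" for x
  have "g x = 0"
  proof (rule subeigen_eq_0[OF w N rad, where g = g])
    fix x assume x: "x \<in> N"
    have nn: "0 \<le> restricted_sum w N g x"
      unfolding restricted_sum_def g_def using wpos by (intro sum_nonneg) auto
    show "r * g x \<le> restricted_sum w N g x"
    proof (cases "h x < 0")
      case True
      have "0 \<le> restricted_sum w (- N) h x"
        unfolding restricted_sum_def using wpos off by (intro sum_nonneg) auto
      then have "r * g x \<le> - restricted_sum w N h x"
        using h[OF x] restricted_sum_split[of w h x N] True by (simp add: g_def)
      also have "\<dots> \<le> restricted_sum w N g x"
        unfolding restricted_sum_def g_def sum_negf[symmetric] mult_minus_right[symmetric]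
        using wpos by (intro sum_mono mult_left_mono) auto
      finally show ?thesis .
    qed (use nn in \<open>simp add: g_def\<close>)
  qed (use True in \<open>auto simp: g_def\<close>)
  then show ?thesis by (simp add: g_def max_def split: if_splits)
qed (use off in simp)

section \<open>Final classes, and the digraph radius as the largest class radius\<close>

lemma restricted_sum_final:
  assumes w: "weighted_digraph w" and D: "D \<in> final_classes w" and x: "x \<in> D"
  shows "restricted_sum w UNIV h x = restricted_sum w D h x"
  unfolding restricted_sum_def
proof (rule sum.mono_neutral_right)
  show "\<forall>y\<in>UNIV - D. w x y * h y = 0"
  proof
    fix y assume y: "y \<in> UNIV - D"
    have "\<not> edge w x y"
    proof
      assume "edge w x y"
      then have "class_accessible w D (access_class_of w y)"
        unfolding class_accessible_def using x access_class_of_mem edge_accessible by metis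
      then have "access_class_of w y = D" using D by (simp add: final_classes_def)
      then show False using access_class_of_mem[of y w] y by auto
    qed
    then show "w x y * h y = 0" using w by (simp add: edge_def weighted_digraph_def less_le)
  qed
qed auto

lemma saturatedI:
  "(\<And>x y. x \<in> N \<Longrightarrow> accessible w x y \<Longrightarrow> accessible w y x \<Longrightarrow> y \<in> N) \<Longrightarrow> saturated w N"
  by (auto simp: saturated_def access_class_of_def)

text \<open>Among the classes of radius at least that of \<open>D\<close>, one with as few vertices having access to
  it as possible: the Perron vector of that class extends to an eigenvector of the whole matrix.\<close>

lemma class_radius_le_digraph_radius:
  fixes w :: "'v::finite \<Rightarrow> 'v \<Rightarrow> real"
  assumes w: "weighted_digraph w" and D: "D \<in> access_classes w"
  shows "class_radius w D \<le> digraph_radius w"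
proof -
  define up where "up x = {y. accessible w y x}" for x
  define S where "S = {x. class_radius w D \<le> class_radius w (access_class_of w x)}"
  obtain d where d: "d \<in> D" using access_class_nonempty[OF D] by blast
  then have "d \<in> S" using access_class_of_eqI[OF D d] by (simp add: S_def)
  then obtain x where x: "x \<in> S" and min: "\<And>y. y \<in> S \<Longrightarrow> card (up x) \<le> card (up y)"
    using ex_has_least_nat[of "\<lambda>x. x \<in> S" d "\<lambda>x. card (up x)"] by blast
  define E where "E = access_class_of w x"
  have E: "E \<in> access_classes w" by (simp add: E_def)
  have xE: "x \<in> E" by (simp add: E_def)
  have DE: "class_radius w D \<le> class_radius w E" using x by (simp add: S_def E_def)
  define N where "N = up x - E"
  have N: "saturated w N"
  proof (rule saturatedI)
    fix y z assume "y \<in> N" "accessible w y z" "accessible w z y"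
    then show "z \<in> N" unfolding N_def up_def E_def access_class_of_def
      by (auto intro: accessible_trans)
  qed
  have rad: "class_radius w C < class_radius w E" if C: "C \<in> access_classes w" "C \<subseteq> N" for C
  proof -
    obtain y where y: "y \<in> C" using access_class_nonempty C by blast
    have Cy: "C = access_class_of w y" using access_class_of_eqI C(1) y by blast
    have "y \<in> N" using y C by blast
    \<comment> \<open>Since y has access to x but lies outside the class of x, the vertex x has no
      access to y; this makes the inclusion strict, and minimality of x excludes y from S.\<close>
    then have "up y \<subset> up x" unfolding N_def up_def E_def access_class_of_def
      by (auto intro: accessible_trans)
    then have "card (up y) < card (up x)" by (intro psubset_card_mono) auto
    then have "y \<notin> S" using min[of y] by auto
    then have "class_radius w C < class_radius w D" using Cy by (simp add: S_def)
    then show ?thesis using DE by simp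
  qed
  obtain v where v: "\<And>x. x \<in> E \<Longrightarrow> 0 < v x"
    and sv: "\<And>x. x \<in> E \<Longrightarrow> restricted_sum w E v x = class_radius w E * v x"
    using class_perron_vector[OF w E] by blast
  have r0: "0 \<le> class_radius w E"
  proof -
    have "0 \<le> restricted_sum w E v x" unfolding restricted_sum_def
      using w v by (intro sum_nonneg) (auto simp: weighted_digraph_def less_imp_le)
    then show ?thesis using sv[OF xE] v[OF xE] by (simp add: zero_le_mult_iff)
  qed
  obtain h where off: "\<And>x. x \<notin> N \<Longrightarrow> h x = (if x \<in> E then v x else 0)"
    and on: "\<And>x. x \<in> N \<Longrightarrow> restricted_sum w UNIV h x = class_radius w E * h x"
    using dirichlet_extension[OF w N r0 rad, of "\<lambda>x. if x \<in> E then v x else 0"] by blast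
  have hE: "h y = v y" if "y \<in> E" for y using off[of y] that by (simp add: N_def)
  have "restricted_sum w UNIV h y = class_radius w E * h y" for y
  proof -
    consider "y \<in> N" | "y \<in> E" | "y \<notin> N" "y \<notin> E" by blast
    then show ?thesis
    proof cases
      case 1
      then show ?thesis by (rule on)
    next
      case 2
      \<comment> \<open>An edge leaving E cannot end in N, since vertices of N have access back to
        x; it ends where h was prescribed to be 0.\<close>
      have "w y z * h z = 0" if "z \<notin> E" for z
      proof (cases "edge w y z")
        case True
        have "z \<notin> N"
        proof
          assume "z \<in> N"
          then have "accessible w z x" by (simp add: N_def up_def)
          moreover have "accessible w x z" using 2 True
            by (auto simp: E_def access_class_of_def intro: accessible_trans edge_accessible)
          ultimately show False using that by (simp add: E_def access_class_of_def)
        qed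
        then show ?thesis using off that by simp
      qed (use w in \<open>auto simp: edge_def weighted_digraph_def less_le\<close>)
      then have "restricted_sum w UNIV h y = restricted_sum w E h y"
        unfolding restricted_sum_def by (intro sum.mono_neutral_right) auto
      also have "\<dots> = restricted_sum w E v y" unfolding restricted_sum_def
        using hE by simp
      also have "\<dots> = class_radius w E * h y" using sv[OF 2] hE[OF 2] by simp
      finally show ?thesis .
    next
      case 3
      then have "y \<notin> up x" by (simp add: N_def)
      \<comment> \<open>If y has no access to x, neither has any successor of y, so h is 0 at all of
        them and at y itself.\<close>
      have "w y z * h z = 0" for z
      proof (cases "edge w y z")
        case True
        then have "z \<notin> up x" using \<open>y \<notin> up x\<close> accessible_trans edge_accessible
          by (fastforce simp: up_def)
        moreover then have "z \<notin> E" by (simp add: up_def E_def access_class_of_def)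
        ultimately show ?thesis using off[of z] by (simp add: N_def)
      qed (use w in \<open>auto simp: edge_def weighted_digraph_def less_le\<close>)
      then show ?thesis using off[of y] 3 by (simp add: restricted_sum_def)
    qed
  qed
  moreover have "h x \<noteq> 0" using hE[OF xE] v[OF xE] by simp
  ultimately have "\<bar>class_radius w E\<bar> \<le> digraph_radius w" unfolding digraph_radius_def
    by (intro eigenvalue_le_block_radius[where h = h and ?x0.0 = x]) auto
  then show ?thesis using DE by simp
qed

text \<open>The moduli of an eigenvector of the whole matrix are localised to one class, whose
  radius is therefore at least that of the digraph; the reverse inequality holds for every
  class.\<close>

lemma digraph_radius_attained:
  fixes w :: "'v::finite \<Rightarrow> 'v \<Rightarrow> real"
  assumes w: "weighted_digraph w"
  obtains D where "D \<in> access_classes w" "class_radius w D = digraph_radius w"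
proof -
  obtain g x0 where g: "\<And>x. 0 \<le> g x" "g x0 \<noteq> 0"
    "\<And>x. digraph_radius w * g x \<le> restricted_sum w UNIV g x"
    using block_radius_subeigen[OF w, of UNIV] unfolding digraph_radius_def by auto
  have "saturated w UNIV" by (simp add: saturated_def)
  then obtain D where "D \<in> access_classes w" "digraph_radius w \<le> class_radius w D"
    using subeigen_le_some_class_radius[OF w, of UNIV g "digraph_radius w" x0] g by auto
  then show thesis using that class_radius_le_digraph_radius[OF w] by (metis order.antisym)
qed

text \<open>Among the vertices accessible from x choose y with the fewest accessible vertices. A
  vertex reached from y without return would have strictly fewer, so the class of y is
  final.\<close>

lemma final_class_accessible:
  fixes w :: "'v::finite \<Rightarrow> 'v \<Rightarrow> real"
  obtains D y where "D \<in> final_classes w" "y \<in> D" "accessible w x y"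
proof -
  define down where "down y = {z. accessible w y z}" for y
  have "accessible w x x" by simp
  then obtain y where y: "accessible w x y" and min: "\<And>z. accessible w x z \<Longrightarrow> card (down y) \<le> card (down z)"
    using ex_has_least_nat[of "accessible w x" x "\<lambda>x. card (down x)"] by blast
  have returns: "accessible w z y" if "accessible w y z" for z
  proof (rule ccontr)
    assume "\<not> accessible w z y"
    then have "down z \<subset> down y" using that by (auto simp: down_def intro: accessible_trans)
    then have "card (down z) < card (down y)" by (intro psubset_card_mono) auto
    then show False using min[of z] that y accessible_trans by (metis leD)
  qed
  have "access_class_of w y \<in> final_classes w"
    unfolding final_classes_def
  proof (intro CollectI conjI ballI impI)
    fix E assume E: "E \<in> access_classes w" "class_accessible w (access_class_of w y) E"
    then obtain a b where ab: "a \<in> access_class_of w y" "b \<in> E" "accessible w a b"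
      by (auto simp: class_accessible_def)
    then have "accessible w y b" by (auto simp: access_class_of_def intro: accessible_trans)
    then have "b \<in> access_class_of w y" using returns by (simp add: access_class_of_def)
    then show "E = access_class_of w y"
      using access_class_of_eqI[OF E(1) ab(2)] access_class_of_eqI[of "access_class_of w y" w b] by simp
  qed simp
  then show thesis using that y by (meson access_class_of_mem)
qed

section \<open>Measures on the space of infinite paths\<close>

lemma finite_paths_nth_edge:
  "u \<in> finite_paths w x \<Longrightarrow> i < path_length u \<Longrightarrow> edge w (u ! i) (u ! Suc i)"
  by (auto simp: finite_paths_def path_length_def successively_conv_nth)

lemma finite_paths_nth_0: "u \<in> finite_paths w x \<Longrightarrow> u ! 0 = x"
  by (auto simp: finite_paths_def hd_conv_nth)

lemma finite_paths_last: "u \<in> finite_paths w x \<Longrightarrow> last u = u ! path_length u"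
  by (auto simp: finite_paths_def path_length_def last_conv_nth)

lemma finite_paths_length: "u \<in> finite_paths w x \<Longrightarrow> length u = Suc (path_length u)"
  by (auto simp: finite_paths_def path_length_def)

text \<open>Here n is the path length of the prefix, which thus has n + 1 vertices.\<close>

definition path_prefix :: "nat \<Rightarrow> (nat \<Rightarrow> 'v) \<Rightarrow> 'v list" where
  "path_prefix n \<omega> = map \<omega> [0..<Suc n]"

lemma path_prefix_finite_paths:
  "\<omega> \<in> infinite_paths w x \<Longrightarrow> path_prefix n \<omega> \<in> finite_paths w x"
  by (auto simp: infinite_paths_def finite_paths_def path_prefix_def successively_conv_nth hd_map
      simp del: upt_Suc)

lemma path_prefix_cylinder: "\<omega> \<in> infinite_paths w x \<Longrightarrow> \<omega> \<in> cylinder w x (path_prefix n \<omega>)"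
  by (auto simp: cylinder_def path_prefix_def simp del: upt_Suc)

lemma cylinder_subset: "cylinder w x u \<subseteq> infinite_paths w x"
  by (auto simp: cylinder_def)

lemma topspace_path_topology [simp]: "topspace (path_topology w x) = infinite_paths w x"
  by (auto simp: path_topology_def)

lemma openin_cylinder: "openin (path_topology w x) (cylinder w x u)"
proof -
  let ?T = "product_topology (\<lambda>_. discrete_topology (UNIV :: 'a set)) (UNIV :: nat set)"
  let ?B = "Pi\<^sub>E UNIV (\<lambda>i. if i < length u then {u ! i} else UNIV)"
  have "openin ?T ?B"
    unfolding openin_PiE_gen
    by (auto intro: finite_subset[of _ "{..<length u}"] split: if_splits)
  moreover have "cylinder w x u = ?B \<inter> infinite_paths w x"
    by (auto simp: cylinder_def PiE_iff split: if_splits)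
  ultimately show ?thesis unfolding path_topology_def openin_subtopology by blast
qed

lemma open_path_neighbourhood:
  assumes U: "openin (path_topology w x) U" and "\<omega> \<in> U"
  shows "\<exists>n. cylinder w x (path_prefix n \<omega>) \<subseteq> U"
proof -
  let ?T = "product_topology (\<lambda>_. discrete_topology (UNIV :: 'a set)) (UNIV :: nat set)"
  obtain T where T: "openin ?T T" and UT: "U = T \<inter> infinite_paths w x"
    using U unfolding path_topology_def openin_subtopology by blast
  obtain X where X: "finite {i. X i \<noteq> UNIV}" "\<omega> \<in> Pi\<^sub>E UNIV X" "Pi\<^sub>E UNIV X \<subseteq> T"
    using T \<open>\<omega> \<in> U\<close> UT unfolding openin_product_topology_alt by auto
  \<comment> \<open>The last constrained coordinate of the box; inserting 0 keeps the maximum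
    defined for a box without constraints.\<close>
  define n where "n = Max (insert 0 {i. X i \<noteq> UNIV})"
  have n: "i \<le> n" if "X i \<noteq> UNIV" for i unfolding n_def using X(1) that by (intro Max_ge) auto
  have "cylinder w x (path_prefix n \<omega>) \<subseteq> U"
  proof
    fix \<eta> assume eta: "\<eta> \<in> cylinder w x (path_prefix n \<omega>)"
    have agree: "\<eta> i = \<omega> i" if "i \<le> n" for i
    proof -
      have "i < length (path_prefix n \<omega>)" using that by (simp add: path_prefix_def)
      then have "\<eta> i = path_prefix n \<omega> ! i" using eta by (simp add: cylinder_def)
      also have "\<dots> = \<omega> i" using that by (simp add: path_prefix_def del: upt_Suc)
      finally show ?thesis .
    qed
    have "\<eta> i \<in> X i" for i
    proof (cases "X i = UNIV")
      case False
      then have "\<eta> i = \<omega> i" using n agree by blast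
      then show ?thesis using X(2) by (auto simp: PiE_iff)
    qed simp
    then have "\<eta> \<in> Pi\<^sub>E UNIV X" by (simp add: PiE_iff)
    then show "\<eta> \<in> U" using X(3) UT eta cylinder_subset by blast
  qed
  then show ?thesis by blast
qed

lemma openin_path_topology_Pow: "{U. openin (path_topology w x) U} \<subseteq> Pow (infinite_paths w x)"
  using openin_subset[of "path_topology w x"] by auto

lemma space_path_borel [simp]: "space (path_borel w x) = infinite_paths w x"
  unfolding path_borel_def by (rule space_measure_of[OF openin_path_topology_Pow])

text \<open>Every path in an open set has a prefix whose cylinder stays in the set. As there are
  only countably many finite paths, open sets are countable unions of cylinders.\<close>

lemma sets_path_borel:
  "sets (path_borel w x) = sigma_sets (infinite_paths w x) (cylinder w x ` finite_paths w x)"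
proof -
  have "sets (path_borel w x) = sigma_sets (infinite_paths w x) {U. openin (path_topology w x) U}"
    unfolding path_borel_def by (rule sets_measure_of[OF openin_path_topology_Pow])
  also have "\<dots> = sigma_sets (infinite_paths w x) (cylinder w x ` finite_paths w x)"
  proof (rule sigma_sets_eqI)
    fix U assume "U \<in> {U. openin (path_topology w x) U}"
    then have U: "openin (path_topology w x) U" by simp
    let ?C = "{u \<in> finite_paths w x. cylinder w x u \<subseteq> U}"
    have "U = (\<Union>u\<in>?C. cylinder w x u)"
    proof
      show "U \<subseteq> (\<Union>u\<in>?C. cylinder w x u)"
      proof
        fix \<omega> assume "\<omega> \<in> U"
        then have \<omega>: "\<omega> \<in> infinite_paths w x" using openin_subset[OF U] by auto
        obtain n where "cylinder w x (path_prefix n \<omega>) \<subseteq> U"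
          using open_path_neighbourhood[OF U \<open>\<omega> \<in> U\<close>] by blast
        then show "\<omega> \<in> (\<Union>u\<in>?C. cylinder w x u)"
          using path_prefix_finite_paths[OF \<omega>] path_prefix_cylinder[OF \<omega>] by blast
      qed
    qed auto
    moreover have "(\<Union>u\<in>?C. cylinder w x u) \<in> sigma_sets (infinite_paths w x) (cylinder w x ` finite_paths w x)"
      by (rule sigma_sets_UNION) (auto intro!: sigma_sets.Basic countable_image)
    ultimately show "U \<in> sigma_sets (infinite_paths w x) (cylinder w x ` finite_paths w x)" by simp
  next
    fix C assume "C \<in> cylinder w x ` finite_paths w x"
    then show "C \<in> sigma_sets (infinite_paths w x) {U. openin (path_topology w x) U}"
      using openin_cylinder by (auto intro!: sigma_sets.Basic)
  qed
  finally show ?thesis .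
qed

lemma cylinder_sets [measurable]: "u \<in> finite_paths w x \<Longrightarrow> cylinder w x u \<in> sets (path_borel w x)"
  unfolding sets_path_borel by (auto intro: sigma_sets.Basic)

lemma cylinder_Int:
  assumes "length u \<le> length u'"
  shows "cylinder w x u \<inter> cylinder w x u' = cylinder w x u' \<or> cylinder w x u \<inter> cylinder w x u' = {}"
proof (cases "\<forall>i<length u. u ! i = u' ! i")
  case True
  then have "cylinder w x u' \<subseteq> cylinder w x u" using assms by (auto simp: cylinder_def)
  then show ?thesis by blast
next
  case False
  then obtain i where "i < length u" "u ! i \<noteq> u' ! i" by blast
  then have "cylinder w x u \<inter> cylinder w x u' = {}" using assms by (auto simp: cylinder_def)
  then show ?thesis by blast
qed

text \<open>Two cylinders are nested or disjoint, so with the empty set added they form a generator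
  stable under intersection, and \<open>cylinder w x [x]\<close> is the whole space. Probability
  measures agreeing on such a generator coincide.\<close>

lemma path_measure_eqI:
  assumes "prob_space M" "prob_space M'"
    and s: "sets M = sets (path_borel w x)" "sets M' = sets (path_borel w x)"
    and eq: "\<And>u. u \<in> finite_paths w x \<Longrightarrow> measure M (cylinder w x u) = measure M' (cylinder w x u)"
  shows "M = M'"
proof -
  interpret M: prob_space M by fact
  interpret M': prob_space M' by fact
  let ?E = "insert {} (cylinder w x ` finite_paths w x)"
  have sub: "?E \<subseteq> Pow (infinite_paths w x)" using cylinder_subset by fastforce
  have sE: "sets (path_borel w x) = sigma_sets (infinite_paths w x) ?E"
    unfolding sets_path_borel
    by (rule sigma_sets_eqI) (auto intro: sigma_sets.Basic sigma_sets.Empty)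
  have x: "[x] \<in> finite_paths w x" by (simp add: finite_paths_def)
  have cx: "cylinder w x [x] = infinite_paths w x" by (auto simp: cylinder_def infinite_paths_def)
  show ?thesis
  proof (rule measure_eqI_generator_eq[where E = ?E and \<Omega> = "infinite_paths w x" and A = "\<lambda>_. cylinder w x [x]"])
    show "Int_stable ?E"
    proof (rule Int_stableI)
      fix a b assume ab: "a \<in> ?E" "b \<in> ?E"
      show "a \<inter> b \<in> ?E"
      proof (cases "a = {} \<or> b = {}")
        case False
        then obtain u u' where u: "u \<in> finite_paths w x" "u' \<in> finite_paths w x"
          "a = cylinder w x u" "b = cylinder w x u'" using ab by auto
        show ?thesis
        proof (cases "length u \<le> length u'")
          case True
          then show ?thesis using cylinder_Int[OF True, of w x] u ab by auto
        next
          case False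
          then have "length u' \<le> length u" by simp
          from cylinder_Int[OF this, of w x] show ?thesis using u ab by (auto simp: Int_commute)
        qed
      qed auto
    qed
    show "emeasure M X = emeasure M' X" if "X \<in> ?E" for X
      using that eq by (auto simp: M.emeasure_eq_measure M'.emeasure_eq_measure)
    show "range (\<lambda>_. cylinder w x [x]) \<subseteq> ?E" using x by auto
  qed (use sub s sE cx in auto)
qed

section \<open>Path measures of a Markov chain\<close>

context
  fixes w :: "'v::finite \<Rightarrow> 'v \<Rightarrow> real" and P :: "'v \<Rightarrow> 'v \<Rightarrow> real"
  assumes P_nonneg: "\<And>x y. 0 \<le> P x y" and P_sum: "\<And>x. (\<Sum>y\<in>UNIV. P x y) = 1"
    and P_edge: "\<And>x y. P x y \<noteq> 0 \<Longrightarrow> edge w x y"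
begin

definition kernel :: "'v \<Rightarrow> 'v pmf" where
  "kernel x = embed_pmf (P x)"

lemma pmf_kernel: "pmf (kernel x) y = P x y"
  unfolding kernel_def
proof (rule pmf_embed_pmf)
  have "(\<integral>\<^sup>+ y. ennreal (P x y) \<partial>count_space UNIV) = (\<Sum>y\<in>UNIV. ennreal (P x y))"
    by (rule nn_integral_count_space_finite) simp
  also have "\<dots> = 1" using P_sum[of x] P_nonneg by (simp add: sum_ennreal)
  finally show "(\<integral>\<^sup>+ y. ennreal (P x y) \<partial>count_space UNIV) = 1" .
qed (rule P_nonneg)

text \<open>Steps that are not edges have probability 0; they are redirected so that every walk is an
  infinite path.\<close>

definition walk_step :: "'v \<Rightarrow> 'v \<Rightarrow> 'v" where
  "walk_step x a = (if edge w x a then a else (SOME b. edge w x b))"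

lemma edge_walk_step: "edge w x (walk_step x a)"
proof -
  have "\<exists>b. P x b \<noteq> 0" using P_sum[of x] by (metis sum.neutral zero_neq_one)
  then have "\<exists>b. edge w x b" using P_edge by blast
  then show ?thesis by (auto simp: walk_step_def intro: someI_ex)
qed

text \<open>Redirected values are not edges, hence lie outside the support of the kernel; within the
  support only y itself is sent to y.\<close>

lemma measure_walk_step: 
  assumes "edge w x y"
  shows "measure (measure_pmf (kernel x)) {a. walk_step x a = y} = P x y"
proof -
  have "{a. walk_step x a = y} \<inter> set_pmf (kernel x) = {y} \<inter> set_pmf (kernel x)"
    using P_edge by (auto simp: walk_step_def set_pmf_iff pmf_kernel)
  then have "measure (measure_pmf (kernel x)) {a. walk_step x a = y} = measure (measure_pmf (kernel x)) {y}"
    by (metis measure_Int_set_pmf)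
  then show ?thesis by (simp add: measure_pmf_single pmf_kernel)
qed

primrec walk :: "'v \<Rightarrow> (nat \<times> 'v \<Rightarrow> 'v) \<Rightarrow> nat \<Rightarrow> 'v" where
  "walk x \<xi> 0 = x"
| "walk x \<xi> (Suc n) = walk_step (walk x \<xi> n) (\<xi> (n, walk x \<xi> n))"

lemma walk_infinite_paths: "walk x \<xi> \<in> infinite_paths w x"
  by (simp add: infinite_paths_def edge_walk_step)

text \<open>While the walk follows u, the coordinates it reads are the pairs (i, u ! i). An event
  about an adaptive walk thus becomes a condition on coordinates fixed in advance, a box of the
  product space.\<close>

lemma walk_cylinder_iff:
  assumes u: "u \<in> finite_paths w x"
  shows "walk x \<xi> \<in> cylinder w x u \<longleftrightarrow> (\<forall>i<path_length u. walk_step (u ! i) (\<xi> (i, u ! i)) = u ! Suc i)"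
proof
  assume "walk x \<xi> \<in> cylinder w x u"
  then have *: "walk x \<xi> i = u ! i" if "i \<le> path_length u" for i
    using that finite_paths_length[OF u] by (simp add: cylinder_def)
  show "\<forall>i<path_length u. walk_step (u ! i) (\<xi> (i, u ! i)) = u ! Suc i"
  proof (intro allI impI)
    fix i assume "i < path_length u"
    then show "walk_step (u ! i) (\<xi> (i, u ! i)) = u ! Suc i" using *[of i] *[of "Suc i"] by simp
  qed
next
  assume *: "\<forall>i<path_length u. walk_step (u ! i) (\<xi> (i, u ! i)) = u ! Suc i"
  have "i \<le> path_length u \<Longrightarrow> walk x \<xi> i = u ! i" for i
    by (induction i) (use * finite_paths_nth_0[OF u] in auto)
  then show "walk x \<xi> \<in> cylinder w x u"
    using finite_paths_length[OF u] walk_infinite_paths by (auto simp: cylinder_def)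
qed

text \<open>One independent random step for each pair of a time and a vertex: a finite path uses
  different pairs at different times, so its probability is a product.\<close>

definition step_space :: "(nat \<times> 'v \<Rightarrow> 'v) measure" where
  "step_space = PiM UNIV (\<lambda>(n, y). measure_pmf (kernel y))"

lemma walk_cylinder_measure:
  assumes u: "u \<in> finite_paths w x"
  shows "{\<xi> \<in> space step_space. walk x \<xi> \<in> cylinder w x u} \<in> sets step_space"
    and "measure step_space {\<xi> \<in> space step_space. walk x \<xi> \<in> cylinder w x u} =
      (\<Prod>i<path_length u. P (u ! i) (u ! Suc i))"
proof -
  let ?M = "\<lambda>(n::nat, y). measure_pmf (kernel y)"
  interpret product_prob_space ?M UNIV
    by unfold_locales (auto intro: measure_pmf.prob_space_axioms split: prod.split)
  define J where "J = (\<lambda>i. (i, u ! i)) ` {..<path_length u}"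
  define X where "X = (\<lambda>(i, y). {a. walk_step y a = u ! Suc i})"
  have inj: "inj_on (\<lambda>i. (i, u ! i)) {..<path_length u}" by (auto simp: inj_on_def)
  have J: "finite J" by (simp add: J_def)
  have eq: "{\<xi> \<in> space step_space. walk x \<xi> \<in> cylinder w x u} = prod_emb UNIV ?M J (Pi\<^sub>E J X)"
    unfolding walk_cylinder_iff[OF u]
    by (auto simp: prod_emb_def step_space_def space_PiM J_def X_def PiE_iff split: prod.splits)
  show "{\<xi> \<in> space step_space. walk x \<xi> \<in> cylinder w x u} \<in> sets step_space"
    unfolding eq unfolding step_space_def
    by (rule sets_PiM_I) (auto simp: J split: prod.split)
  have "measure step_space {\<xi> \<in> space step_space. walk x \<xi> \<in> cylinder w x u} =
      (\<Prod>j\<in>J. measure (?M j) (X j))"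
    unfolding eq unfolding step_space_def
    by (rule measure_PiM_emb) (auto simp: J split: prod.split)
  also have "\<dots> = (\<Prod>i<path_length u. measure (?M (i, u ! i)) (X (i, u ! i)))"
    unfolding J_def by (simp add: prod.reindex[OF inj])
  also have "\<dots> = (\<Prod>i<path_length u. P (u ! i) (u ! Suc i))"
    by (rule prod.cong) (auto simp: X_def measure_walk_step finite_paths_nth_edge[OF u])
  finally show "measure step_space {\<xi> \<in> space step_space. walk x \<xi> \<in> cylinder w x u} =
      (\<Prod>i<path_length u. P (u ! i) (u ! Suc i))" .
qed

lemma measurable_walk: "walk x \<in> measurable step_space (path_borel w x)"
proof (rule measurable_sigma_sets[OF sets_path_borel])
  show "cylinder w x ` finite_paths w x \<subseteq> Pow (infinite_paths w x)" using cylinder_subset by fastforce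
  show "walk x \<in> space step_space \<rightarrow> infinite_paths w x" using walk_infinite_paths by simp
  fix C assume "C \<in> cylinder w x ` finite_paths w x"
  then obtain u where u: "u \<in> finite_paths w x" "C = cylinder w x u" by blast
  have "walk x -` C \<inter> space step_space = {\<xi> \<in> space step_space. walk x \<xi> \<in> cylinder w x u}"
    using u by auto
  then show "walk x -` C \<inter> space step_space \<in> sets step_space"
    using walk_cylinder_measure(1)[OF u(1)] by simp
qed

text \<open>All the measures are images of one product measure under the walks with the various
  starting points.\<close>

lemma markov_path_measure_exists:
  "\<exists>\<mu>. path_probability_family w \<mu> \<and> (\<forall>x. \<forall>u\<in>finite_paths w x.
     measure (\<mu> x) (cylinder w x u) = (\<Prod>i<path_length u. P (u ! i) (u ! Suc i)))"
proof (intro exI conjI allI ballI)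
  interpret product_prob_space "\<lambda>(n::nat, y). measure_pmf (kernel y)" UNIV
    by unfold_locales (auto intro: measure_pmf.prob_space_axioms split: prod.split)
  let ?\<mu> = "\<lambda>x. distr step_space (path_borel w x) (walk x)"
  have "prob_space step_space" unfolding step_space_def by (rule P.prob_space_axioms)
  then show "path_probability_family w ?\<mu>"
    unfolding path_probability_family_def
    using measurable_walk by (auto intro: prob_space.prob_space_distr)
  fix x u assume u: "u \<in> finite_paths w x"
  have "measure (?\<mu> x) (cylinder w x u) = measure step_space (walk x -` cylinder w x u \<inter> space step_space)"
    using u by (intro measure_distr measurable_walk cylinder_sets)
  also have "walk x -` cylinder w x u \<inter> space step_space =
      {\<xi> \<in> space step_space. walk x \<xi> \<in> cylinder w x u}" by auto
  finally show "measure (?\<mu> x) (cylinder w x u) = (\<Prod>i<path_length u. P (u ! i) (u ! Suc i))"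
    using walk_cylinder_measure(2)[OF u] by simp
qed

end

section \<open>Positive eigenfunctions and complete cocycle measures\<close>

definition eigenfunction :: "('v::finite \<Rightarrow> 'v \<Rightarrow> real) \<Rightarrow> real \<Rightarrow> ('v \<Rightarrow> real) \<Rightarrow> bool" where
  "eigenfunction w r h \<longleftrightarrow> (\<forall>x. restricted_sum w UNIV h x = r * h x)"

text \<open>This is Doob's h-transform: the eigenvalue equation says that the rows of
  \<open>P\<close> sum to 1, and along a path the quotients of h telescope to the cocycle
  factor.\<close>

lemma eigenfunction_cocycle_measure:
  fixes w :: "'v::finite \<Rightarrow> 'v \<Rightarrow> real"
  assumes w: "weighted_digraph w" and r: "0 < r" and h: "\<And>x. 0 < h x" and eig: "eigenfunction w r h"
  shows "\<exists>\<mu>. cocycle_measure_for w r (\<lambda>x y. h y / h x) \<mu>"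
proof -
  have wpos: "0 \<le> w x y" for x y using w by (simp add: weighted_digraph_def)
  define P where "P x y = (w x y / r) * (h y / h x)" for x y
  have "\<exists>\<mu>. path_probability_family w \<mu> \<and> (\<forall>x. \<forall>u\<in>finite_paths w x.
     measure (\<mu> x) (cylinder w x u) = (\<Prod>i<path_length u. P (u ! i) (u ! Suc i)))"
  proof (rule markov_path_measure_exists)
    show "0 \<le> P x y" for x y using wpos r h by (simp add: P_def less_imp_le)
    show "(\<Sum>y\<in>UNIV. P x y) = 1" for x
    proof -
      have "(\<Sum>y\<in>UNIV. P x y) = restricted_sum w UNIV h x / (r * h x)"
        by (simp add: P_def restricted_sum_def sum_divide_distrib)
      then show ?thesis using eig r h[of x] by (simp add: eigenfunction_def)
    qed
    show "edge w x y" if "P x y \<noteq> 0" for x y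
      using that wpos[of x y] by (auto simp: P_def edge_def less_le)
  qed
  then obtain \<mu> where \<mu>: "path_probability_family w \<mu>"
    and eq: "\<And>x u. u \<in> finite_paths w x \<Longrightarrow>
      measure (\<mu> x) (cylinder w x u) = (\<Prod>i<path_length u. P (u ! i) (u ! Suc i))"
    by blast
  have "cocycle_measure_for w r (\<lambda>x y. h y / h x) \<mu>"
    unfolding cocycle_measure_for_def
  proof (intro conjI allI ballI)
    show "cocycle w (\<lambda>x y. h y / h x)"
      unfolding cocycle_def using h less_imp_neq[OF h] by (auto simp: less_imp_le)
    fix x u assume u: "u \<in> finite_paths w x"
    have "(\<Prod>i<path_length u. h (u ! Suc i) / h (u ! i)) = h (u ! path_length u) / h (u ! 0)"
      using prod_lessThan_telescope[of "path_length u" "\<lambda>i. h (u ! i)"] less_imp_neq[OF h]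
      by (metis)
    then show "measure (\<mu> x) (cylinder w x u) =
        inverse (r ^ path_length u) * path_weight w u * (h (last u) / h x)"
      unfolding eq[OF u] P_def prod.distrib
      by (simp add: path_weight_def prod_dividef finite_paths_last[OF u] finite_paths_nth_0[OF u] field_simps)
  qed (use \<mu> r in auto)
  then show ?thesis by blast
qed

text \<open>Splitting by the first step out of z gives r as the sum of w z y *
  \<open>\<Gamma> z y\<close>; multiplying by \<open>\<Gamma> x z\<close> and using the cocycle
  identity moves the base point from z to x.\<close>

lemma complete_cocycle_sum:
  fixes w :: "'v::finite \<Rightarrow> 'v \<Rightarrow> real"
  assumes w: "weighted_digraph w" and m: "cocycle_measure_for w r \<Gamma> \<mu>"
    and pos: "\<And>x y. accessible w x y \<Longrightarrow> 0 < \<Gamma> x y" and xz: "accessible w x z"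
  shows "restricted_sum w UNIV (\<Gamma> x) z = r * \<Gamma> x z"
proof -
  have fam: "prob_space (\<mu> z)" "sets (\<mu> z) = sets (path_borel w z)" and r: "0 < r"
    and coc: "\<And>x y z. accessible w x y \<Longrightarrow> accessible w y z \<Longrightarrow> \<Gamma> x z = \<Gamma> x y * \<Gamma> y z"
    and cyl: "\<And>x u. u \<in> finite_paths w x \<Longrightarrow> measure (\<mu> x) (cylinder w x u) =
          inverse (r ^ path_length u) * path_weight w u * \<Gamma> x (last u)"
    using m by (auto simp: cocycle_measure_for_def path_probability_family_def cocycle_def)
  interpret prob_space "\<mu> z" by (rule fam)
  let ?S = "{y. edge w z y}"
  have zy: "[z, y] \<in> finite_paths w z" if "edge w z y" for y using that by (simp add: finite_paths_def)
  have "space (\<mu> z) = infinite_paths w z" using sets_eq_imp_space_eq[OF fam(2)] by simp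
  also have "\<dots> = (\<Union>y\<in>?S. cylinder w z [z, y])"
    by (auto simp: cylinder_def infinite_paths_def less_Suc_eq nth_Cons')
  finally have "1 = measure (\<mu> z) (\<Union>y\<in>?S. cylinder w z [z, y])" using prob_space by simp
  also have "\<dots> = (\<Sum>y\<in>?S. measure (\<mu> z) (cylinder w z [z, y]))"
  proof (rule finite_measure_finite_Union)
    show "(\<lambda>y. cylinder w z [z, y]) ` ?S \<subseteq> sets (\<mu> z)" using cylinder_sets[OF zy] fam by auto
    show "disjoint_family_on (\<lambda>y. cylinder w z [z, y]) ?S"
      by (auto simp: disjoint_family_on_def cylinder_def)
  qed simp
  also have "\<dots> = (\<Sum>y\<in>?S. inverse r * (w z y * \<Gamma> z y))"
    by (rule sum.cong) (auto simp: cyl[OF zy] path_length_def path_weight_def)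
  also have "\<dots> = inverse r * (\<Sum>y\<in>?S. w z y * \<Gamma> z y)" by (rule sum_distrib_left[symmetric])
  finally have "r = (\<Sum>y\<in>?S. w z y * \<Gamma> z y)" using r by (simp add: inverse_eq_divide)
  then have "r * \<Gamma> x z = (\<Sum>y\<in>?S. w z y * \<Gamma> z y) * \<Gamma> x z" by simp
  also have "\<dots> = (\<Sum>y\<in>?S. w z y * (\<Gamma> x z * \<Gamma> z y))"
    by (simp only: sum_distrib_left mult_ac)
  also have "\<dots> = (\<Sum>y\<in>?S. w z y * \<Gamma> x y)"
    using coc[OF xz edge_accessible] by simp
  also have "\<dots> = restricted_sum w UNIV (\<Gamma> x) z"
    unfolding restricted_sum_def
    by (rule sum.mono_neutral_left) (use w in \<open>auto simp: edge_def weighted_digraph_def less_le\<close>)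
  finally show ?thesis by simp
qed

lemma closed_class_final:
  assumes D: "D \<in> access_classes w" and closed: "\<And>x y. x \<in> D \<Longrightarrow> edge w x y \<Longrightarrow> y \<in> D"
  shows "D \<in> final_classes w"
  unfolding final_classes_def
proof (intro CollectI conjI ballI impI)
  fix E assume E: "E \<in> access_classes w" "class_accessible w D E"
  then obtain x y where xy: "x \<in> D" "y \<in> E" "(edge w)\<^sup>*\<^sup>* x y"
    by (auto simp: class_accessible_def accessible_iff_rtranclp)
  from xy(3) have "y \<in> D" by (induction rule: rtranclp_induct) (use xy(1) closed in auto)
  then show "E = D" using access_class_of_eqI[OF D] access_class_of_eqI[OF E(1) xy(2)] by simp
qed (rule D)

lemma complete_cocycle_umbrella:
  fixes w :: "'v::finite \<Rightarrow> 'v \<Rightarrow> real"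
  assumes w: "weighted_digraph w" and m: "cocycle_measure_for w r \<Gamma> \<mu>"
    and pos: "\<And>x y. accessible w x y \<Longrightarrow> 0 < \<Gamma> x y"
  shows "digraph_radius w = r" "umbrella_digraph w"
proof -
  have wpos: "0 \<le> w x y" for x y using w by (simp add: weighted_digraph_def)
  have r: "0 < r" using m by (simp add: cocycle_measure_for_def)
  have le: "class_radius w D \<le> r" and final: "class_radius w D = r \<longleftrightarrow> D \<in> final_classes w"
    if D: "D \<in> access_classes w" for D
  proof -
    obtain x where x: "x \<in> D" using access_class_nonempty[OF D] by blast
    have acc: "accessible w x y" if "y \<in> D" for y using access_class_accessible[OF D x that] .
    have v: "0 < \<Gamma> x y" if "y \<in> D" for y using pos acc that by simp
    \<comment> \<open>Off the accessible pairs \<open>\<Gamma>\<close> is unconstrained and may be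
      negative; there is no edge from z to such a y, so the weight is 0.\<close>
    have nn: "0 \<le> w z y * \<Gamma> x y" if "z \<in> D" for y z
    proof (cases "edge w z y")
      case True
      then have "0 < \<Gamma> x y" using pos acc[OF that] accessible_trans edge_accessible by metis
      then show ?thesis using wpos by simp
    qed (use wpos[of z y] in \<open>simp add: edge_def\<close>)
    have rest: "0 \<le> restricted_sum w (- D) (\<Gamma> x) z" if "z \<in> D" for z
      unfolding restricted_sum_def using nn[OF that] by (intro sum_nonneg) auto
    have split: "restricted_sum w D (\<Gamma> x) z + restricted_sum w (- D) (\<Gamma> x) z = r * \<Gamma> x z"
      if "z \<in> D" for z
      using complete_cocycle_sum[OF w m pos acc[OF that]] restricted_sum_split[of w "\<Gamma> x" z D] by simp
    have sv: "restricted_sum w D (\<Gamma> x) z \<le> r * \<Gamma> x z" if "z \<in> D" for z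
      using split[OF that] rest[OF that] by simp
    obtain g where g: "\<And>x. x \<in> D \<Longrightarrow> 0 < g x"
      and rg: "\<And>x. x \<in> D \<Longrightarrow> restricted_sum w D g x = class_radius w D * g x"
      by (rule class_perron_vector[OF w D]) (rule that)
    show "class_radius w D \<le> r"
    proof (rule comparison[OF w, of D "\<Gamma> x" r g "class_radius w D" x])
      show "g x \<noteq> 0" using g[OF x] by simp
      show "class_radius w D * g z \<le> restricted_sum w D g z" if "z \<in> D" for z using rg[OF that] by simp
    qed (use v sv g x in \<open>auto simp: less_imp_le\<close>)
    show "class_radius w D = r \<longleftrightarrow> D \<in> final_classes w"
    proof
      assume eq: "class_radius w D = r"
      \<comment> \<open>Equal radii make the comparison rigid: \<open>\<Gamma> x\<close> solves the
        eigenvalue equation of the block exactly, leaving nothing for the sum over the edges that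
        leave D.\<close>
      have c: "restricted_sum w D (\<Gamma> x) z = r * \<Gamma> x z" if "z \<in> D" for z
      proof (rule comparison_rigid[OF w D, of "\<Gamma> x" r g x])
        show "r * g z \<le> restricted_sum w D g z" if "z \<in> D" for z using rg[OF that] eq by simp
        show "g x \<noteq> 0" using g[OF x] by simp
      qed (use v sv g x that in \<open>auto simp: less_imp_le\<close>)
      show "D \<in> final_classes w"
      proof (rule closed_class_final[OF D])
        fix z y assume z: "z \<in> D" and e: "edge w z y"
        show "y \<in> D"
        proof (rule ccontr)
          assume y: "y \<notin> D"
          have "(\<Sum>y\<in>-D. w z y * \<Gamma> x y) = 0"
            using split[OF z] c[OF z] by (simp add: restricted_sum_def)
          then have "w z y * \<Gamma> x y = 0"
            using sum_nonneg_eq_0_iff[of "-D" "\<lambda>y. w z y * \<Gamma> x y"] nn[OF z] y by auto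
          moreover have "0 < \<Gamma> x y" using pos acc[OF z] e accessible_trans edge_accessible by metis
          ultimately show False using e by (simp add: edge_def)
        qed
      qed
    next
      assume F: "D \<in> final_classes w"
      have "\<bar>r\<bar> \<le> class_radius w D" unfolding class_radius_def
      proof (rule eigenvalue_le_block_radius[of D w "\<Gamma> x" r x])
        fix z assume z: "z \<in> D"
        show "restricted_sum w D (\<Gamma> x) z = r * \<Gamma> x z"
          using restricted_sum_final[OF w F z, of "\<Gamma> x"] complete_cocycle_sum[OF w m pos acc[OF z]] by simp
      qed (use x v[OF x] in auto)
      then show "class_radius w D = r" using \<open>class_radius w D \<le> r\<close> by simp
    qed
  qed
  \<comment> \<open>Some class attains the radius of the digraph, which is therefore at most r; some
    class is final and has radius r, which gives the reverse.\<close>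
  obtain C where "C \<in> access_classes w" "class_radius w C = digraph_radius w"
    by (rule digraph_radius_attained[OF w])
  then have "digraph_radius w \<le> r" using le[of C] by simp
  moreover obtain D where D: "D \<in> final_classes w" by (rule final_class_accessible)
  then have "class_radius w D = r" using final by (auto simp: final_classes_def)
  then have "r \<le> digraph_radius w" using class_radius_le_digraph_radius[OF w, of D] D by (auto simp: final_classes_def)
  ultimately show eq: "digraph_radius w = r" by simp
  have "basic_classes w = final_classes w"
    unfolding basic_classes_def eq using final by (auto simp: final_classes_def)
  then show "umbrella_digraph w" using eq r by (simp add: umbrella_digraph_def)
qed

section \<open>Eigenfunctions of an umbrella digraph\<close>

definition transient :: "('v::finite \<Rightarrow> 'v \<Rightarrow> real) \<Rightarrow> 'v set" where
  "transient w = {x. access_class_of w x \<notin> final_classes w}"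

lemma not_transientI: "D \<in> final_classes w \<Longrightarrow> x \<in> D \<Longrightarrow> x \<notin> transient w"
  by (metis (no_types, lifting) access_class_of_eqI final_classes_def mem_Collect_eq transient_def)

lemma not_transientE:
  assumes "x \<notin> transient w"
  obtains D where "D \<in> final_classes w" "x \<in> D"
proof (rule that)
  show "access_class_of w x \<in> final_classes w" using assms by (simp add: transient_def)
qed (rule access_class_of_mem)

lemma saturated_transient: "saturated w (transient w)"
proof (rule saturatedI)
  fix x y assume "x \<in> transient w" "accessible w x y" "accessible w y x"
  moreover from this have "access_class_of w x = access_class_of w y"
    by (auto simp: access_class_of_def intro: accessible_trans)
  ultimately show "y \<in> transient w" by (simp add: transient_def)
qed

text \<open>This uses the half of the umbrella condition saying that basic classes are final. The
  other half, that final classes are basic, supplies their Perron vectors with the right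
  eigenvalue.\<close>

lemma umbrella_transient_radius:
  assumes w: "weighted_digraph w" and u: "umbrella_digraph w"
    and D: "D \<in> access_classes w" "D \<subseteq> transient w"
  shows "class_radius w D < digraph_radius w"
proof -
  obtain x where "x \<in> D" using access_class_nonempty[OF D(1)] by blast
  then have "D \<notin> final_classes w" using not_transientI D by blast
  then have "D \<notin> basic_classes w" using u by (simp add: umbrella_digraph_def)
  then show ?thesis using class_radius_le_digraph_radius[OF w D(1)] D by (auto simp: basic_classes_def)
qed

text \<open>The eigenvalue equation at a vertex of a final class involves only values on that class,
  so it is inherited from b; at the transient vertices it is the Dirichlet problem with b as
  boundary values.\<close>

lemma umbrella_eigenfunction_extension:
  fixes w :: "'v::finite \<Rightarrow> 'v \<Rightarrow> real"
  assumes w: "weighted_digraph w" and u: "umbrella_digraph w"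
    and b0: "\<And>x. x \<notin> transient w \<Longrightarrow> 0 \<le> b x"
    and b: "\<And>D x. D \<in> final_classes w \<Longrightarrow> x \<in> D \<Longrightarrow> restricted_sum w D b x = digraph_radius w * b x"
  obtains h where "\<And>x. 0 \<le> h x" "\<And>x. x \<notin> transient w \<Longrightarrow> h x = b x"
    "eigenfunction w (digraph_radius w) h"
proof -
  have r: "0 \<le> digraph_radius w" using u by (simp add: umbrella_digraph_def)
  note rad = umbrella_transient_radius[OF w u]
  obtain h where off: "\<And>x. x \<notin> transient w \<Longrightarrow> h x = b x"
    and on: "\<And>x. x \<in> transient w \<Longrightarrow> restricted_sum w UNIV h x = digraph_radius w * h x"
  proof (rule dirichlet_extension[OF w saturated_transient r, where b = b])
    show "class_radius w D < digraph_radius w" if "D \<in> access_classes w" "D \<subseteq> transient w" for D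
      using rad that .
  qed (rule that)
  show thesis
  proof (rule that)
    show "0 \<le> h x" for x
      by (rule dirichlet_nonneg[OF w saturated_transient rad _ on]) (use off b0 in auto)
    show "eigenfunction w (digraph_radius w) h"
      unfolding eigenfunction_def
    proof
      fix x
      show "restricted_sum w UNIV h x = digraph_radius w * h x"
      proof (cases "x \<in> transient w")
        case False
        then obtain D where D: "D \<in> final_classes w" "x \<in> D" by (rule not_transientE)
        have "restricted_sum w UNIV h x = restricted_sum w D h x" by (rule restricted_sum_final[OF w D])
        also have "\<dots> = restricted_sum w D b x"
          unfolding restricted_sum_def using off not_transientI[OF D(1)] by (intro sum.cong) auto
        finally show ?thesis using b[OF D] off[OF False] by simp
      qed (rule on)
    qed
  qed (rule off)
qed

text \<open>Positivity travels backwards along an edge from x to z, because r h(x) is a sum of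
  nonnegative terms containing w(x, z) h(z).\<close>

lemma eigenfunction_pos_propagates:
  fixes w :: "'v::finite \<Rightarrow> 'v \<Rightarrow> real"
  assumes w: "weighted_digraph w" and r: "0 < r" and h: "\<And>x. 0 \<le> h x" and eig: "eigenfunction w r h"
    and "accessible w x y" "0 < h y"
  shows "0 < h x"
proof -
  have "(edge w)\<^sup>*\<^sup>* x y" using assms by (simp add: accessible_iff_rtranclp)
  then show ?thesis
  proof (induction rule: converse_rtranclp_induct)
    case (step x z)
    have "0 < w x z * h z" using step by (simp add: edge_def)
    also have "\<dots> \<le> restricted_sum w UNIV h x"
      unfolding restricted_sum_def
      by (rule member_le_sum[of z UNIV "\<lambda>z. w x z * h z"]) (use w h in \<open>auto simp: weighted_digraph_def\<close>)
    also have "\<dots> = r * h x" using eig by (simp add: eigenfunction_def)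
    finally show ?case using r by (simp add: zero_less_mult_iff)
  qed (rule assms)
qed

lemma eigenfunction_pos:
  fixes w :: "'v::finite \<Rightarrow> 'v \<Rightarrow> real"
  assumes w: "weighted_digraph w" and r: "0 < r" and h: "\<And>x. 0 \<le> h x" and eig: "eigenfunction w r h"
    and pos: "\<And>x. x \<notin> transient w \<Longrightarrow> 0 < h x"
  shows "0 < h x"
proof -
  obtain D y where "D \<in> final_classes w" "y \<in> D" "accessible w x y" by (rule final_class_accessible)
  then show ?thesis using eigenfunction_pos_propagates[OF w r h eig] pos not_transientI by metis
qed

text \<open>The difference vanishes on the final classes, so on the transient vertices it satisfies
  the eigenvalue equation of their block alone, where only 0 is possible.\<close>

lemma umbrella_eigenfunction_unique:
  fixes w :: "'v::finite \<Rightarrow> 'v \<Rightarrow> real"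
  assumes w: "weighted_digraph w" and u: "umbrella_digraph w"
    and h: "eigenfunction w (digraph_radius w) h" and h': "eigenfunction w (digraph_radius w) h'"
    and off: "\<And>x. x \<notin> transient w \<Longrightarrow> h x = h' x"
  shows "h = h'"
proof
  fix x
  have r: "0 \<le> digraph_radius w" using u by (simp add: umbrella_digraph_def)
  define d where "d x = h x - h' x" for x
  have "d x = 0" if "x \<in> transient w"
  proof (rule eigen_eq_0[OF w saturated_transient r umbrella_transient_radius[OF w u] _ that])
    fix x assume "x \<in> transient w"
    have "restricted_sum w (transient w) d x = restricted_sum w UNIV d x"
      unfolding restricted_sum_def using off by (intro sum.mono_neutral_left) (auto simp: d_def)
    also have "\<dots> = restricted_sum w UNIV h x - restricted_sum w UNIV h' x"
      by (simp add: restricted_sum_def d_def right_diff_distrib sum_subtractf)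
    also have "\<dots> = digraph_radius w * d x"
      using h h' by (simp add: eigenfunction_def d_def right_diff_distrib)
    finally show "restricted_sum w (transient w) d x = digraph_radius w * d x" .
  qed
  then show "h x = h' x" using off by (cases "x \<in> transient w") (auto simp: d_def)
qed

lemma final_classes_disjoint:
  "D \<in> final_classes w \<Longrightarrow> E \<in> final_classes w \<Longrightarrow> x \<in> D \<Longrightarrow> x \<in> E \<Longrightarrow> D = E"
  by (metis (no_types, lifting) access_class_of_eqI final_classes_def mem_Collect_eq)

lemma umbrella_final_perron:
  fixes w :: "'v::finite \<Rightarrow> 'v \<Rightarrow> real"
  assumes w: "weighted_digraph w" and u: "umbrella_digraph w" and D: "D \<in> final_classes w"
  obtains v where "\<And>x. x \<in> D \<Longrightarrow> 0 < v x"
    "\<And>x. x \<in> D \<Longrightarrow> restricted_sum w D v x = digraph_radius w * v x"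
proof -
  have Da: "D \<in> access_classes w" using D by (simp add: final_classes_def)
  have "class_radius w D = digraph_radius w" using D u by (auto simp: umbrella_digraph_def basic_classes_def)
  note radius = this
  show thesis by (rule class_perron_vector[OF w Da, unfolded radius]) (rule that)
qed

text \<open>The boundary values are the Perron vector on D and 0 on the other final classes. Scaled
  to 1 at x0, these functions become the vertices of the simplex.\<close>

lemma umbrella_final_eigenfunction:
  fixes w :: "'v::finite \<Rightarrow> 'v \<Rightarrow> real"
  assumes w: "weighted_digraph w" and u: "umbrella_digraph w" and D: "D \<in> final_classes w"
  obtains h where "\<And>x. 0 \<le> h x" "eigenfunction w (digraph_radius w) h"
    "\<And>x. x \<in> D \<Longrightarrow> 0 < h x" "\<And>x. x \<notin> transient w \<Longrightarrow> x \<notin> D \<Longrightarrow> h x = 0"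
proof -
  obtain v where v: "\<And>x. x \<in> D \<Longrightarrow> 0 < v x"
    and sv: "\<And>x. x \<in> D \<Longrightarrow> restricted_sum w D v x = digraph_radius w * v x"
    by (rule umbrella_final_perron[OF w u D]) (rule that)
  define b where "b x = (if x \<in> D then v x else 0)" for x
  have bE: "restricted_sum w E b x = digraph_radius w * b x" if E: "E \<in> final_classes w" "x \<in> E" for E x
  proof (cases "E = D")
    case True
    then have "restricted_sum w E b x = restricted_sum w D v x"
      unfolding restricted_sum_def by (intro sum.cong) (auto simp: b_def)
    then show ?thesis using sv E True by (simp add: b_def)
  next
    case False
    then have "b y = 0" if "y \<in> E" for y using final_classes_disjoint[OF E(1) D that] by (auto simp: b_def)
    then show ?thesis using E by (simp add: restricted_sum_def)
  qed
  have b0: "0 \<le> b x" for x using v[of x] by (auto simp: b_def less_imp_le)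
  obtain h where h: "\<And>x. 0 \<le> h x" "\<And>x. x \<notin> transient w \<Longrightarrow> h x = b x"
    "eigenfunction w (digraph_radius w) h"
    by (rule umbrella_eigenfunction_extension[where b = b, OF w u b0]) (erule (1) bE, rule that)
  show thesis
  proof (rule that)
    show "0 < h x" if "x \<in> D" for x using h(2)[of x] not_transientI[OF D that] v[OF that] that by (simp add: b_def)
    show "h x = 0" if "x \<notin> transient w" "x \<notin> D" for x using h(2)[of x] that by (simp add: b_def)
  qed (use h in auto)
qed

section \<open>Parameterisation by the open simplex\<close>

lemma eigenfunction_sum:
  assumes "\<And>i. i \<in> I \<Longrightarrow> eigenfunction w r (H i)"
  shows "eigenfunction w r (\<lambda>x. \<Sum>i\<in>I. t i * H i x)"
  unfolding eigenfunction_def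
proof
  fix x
  have "restricted_sum w UNIV (\<lambda>x. \<Sum>i\<in>I. t i * H i x) x = (\<Sum>i\<in>I. t i * restricted_sum w UNIV (H i) x)"
    unfolding restricted_sum_def sum_distrib_left by (subst sum.swap) (simp add: mult_ac)
  also have "\<dots> = (\<Sum>i\<in>I. t i * (r * H i x))"
    using assms by (intro sum.cong) (auto simp: eigenfunction_def)
  finally show "restricted_sum w UNIV (\<lambda>x. \<Sum>i\<in>I. t i * H i x) x = r * (\<Sum>i\<in>I. t i * H i x)"
    by (simp add: sum_distrib_left mult_ac)
qed

lemma cocycle_measure_unique:
  assumes "cocycle_measure_for w r \<Gamma> \<mu>" "cocycle_measure_for w r \<Gamma>' \<mu>'"
    and eq: "\<And>x y. accessible w x y \<Longrightarrow> \<Gamma> x y = \<Gamma>' x y"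
  shows "\<mu> = \<mu>'"
proof
  fix x
  show "\<mu> x = \<mu>' x"
  proof (rule path_measure_eqI)
    fix u assume u: "u \<in> finite_paths w x"
    then have "\<Gamma> x (last u) = \<Gamma>' x (last u)" by (intro eq) (auto simp: accessible_def)
    then show "measure (\<mu> x) (cylinder w x u) = measure (\<mu>' x) (cylinder w x u)"
      using assms u by (simp add: cocycle_measure_for_def)
  qed (use assms in \<open>auto simp: cocycle_measure_for_def path_probability_family_def\<close>)
qed

text \<open>The cocycle h(y) / h(x) determines h only up to a factor, which the value 1 at x0
  fixes.\<close>

definition positive_eigenfunctions :: "('v::finite \<Rightarrow> 'v \<Rightarrow> real) \<Rightarrow> 'v \<Rightarrow> ('v \<Rightarrow> real) set" where
  "positive_eigenfunctions w x0 =
     {h. (\<forall>x. 0 < h x) \<and> eigenfunction w (digraph_radius w) h \<and> h x0 = 1}"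

lemma path_weight_pos: "u \<in> finite_paths w x \<Longrightarrow> 0 < path_weight w u"
  unfolding path_weight_def
  using finite_paths_nth_edge by (intro prod_pos) (fastforce simp: edge_def)

text \<open>The inverse sends a measure to the row \<open>\<Gamma> x0\<close> of its cocycle, from
  which \<open>\<Gamma> x y\<close> = \<open>\<Gamma> x0 y / \<Gamma> x0 x\<close>. For injectivity,
  h(y) is read off from the measure of the cylinder of any path from x0 to y, whose weight is
  positive.\<close>

lemma complete_cocycle_measures_bij:
  fixes w :: "'v::finite \<Rightarrow> 'v \<Rightarrow> real"
  assumes w: "weighted_digraph w" and u: "umbrella_digraph w" and x0: "\<And>y. accessible w x0 y"
  shows "\<exists>m. bij_betw m (positive_eigenfunctions w x0) {\<mu>. complete_cocycle_measure w \<mu>}"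
proof -
  let ?r = "digraph_radius w" and ?K = "positive_eigenfunctions w x0"
  have r: "0 < ?r" using u by (simp add: umbrella_digraph_def)
  define m where "m h = (SOME \<mu>. cocycle_measure_for w ?r (\<lambda>x y. h y / h x) \<mu>)" for h
  have m: "cocycle_measure_for w ?r (\<lambda>x y. h y / h x) (m h)" if "h \<in> ?K" for h
  proof -
    have "\<exists>\<mu>. cocycle_measure_for w ?r (\<lambda>x y. h y / h x) \<mu>"
      using that by (intro eigenfunction_cocycle_measure[OF w r]) (auto simp: positive_eigenfunctions_def)
    then show ?thesis unfolding m_def by (rule someI_ex)
  qed
  have "bij_betw m ?K {\<mu>. complete_cocycle_measure w \<mu>}"
    unfolding bij_betw_def
  proof (intro conjI inj_onI equalityI subsetI)
    fix h h' assume h: "h \<in> ?K" "h' \<in> ?K" and eq: "m h = m h'"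
    show "h = h'"
    proof
      fix y
      obtain p where p: "p \<in> finite_paths w x0" "last p = y" using x0[of y] by (auto simp: accessible_def)
      have "measure (m h x0) (cylinder w x0 p) = inverse (?r ^ path_length p) * path_weight w p * h y"
        using m[OF h(1)] p h by (simp add: cocycle_measure_for_def positive_eigenfunctions_def)
      moreover have "measure (m h' x0) (cylinder w x0 p) = inverse (?r ^ path_length p) * path_weight w p * h' y"
        using m[OF h(2)] p h by (simp add: cocycle_measure_for_def positive_eigenfunctions_def)
      ultimately show "h y = h' y" using eq path_weight_pos[OF p(1)] r by simp
    qed
  next
    fix \<mu> assume "\<mu> \<in> m ` ?K"
    then obtain h where h: "h \<in> ?K" "\<mu> = m h" by blast
    then have "0 < h x" for x by (simp add: positive_eigenfunctions_def)
    then show "\<mu> \<in> {\<mu>. complete_cocycle_measure w \<mu>}"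
      using m[OF h(1)] h(2) unfolding complete_cocycle_measure_def
      by (intro CollectI exI[of _ ?r] exI[of _ "\<lambda>x y. h y / h x"]) simp
  next
    fix \<mu> assume "\<mu> \<in> {\<mu>. complete_cocycle_measure w \<mu>}"
    then obtain \<rho> \<Gamma> where c: "cocycle_measure_for w \<rho> \<Gamma> \<mu>" and pos: "\<And>x y. accessible w x y \<Longrightarrow> 0 < \<Gamma> x y"
      by (auto simp: complete_cocycle_measure_def)
    have \<rho>: "\<rho> = ?r" using complete_cocycle_umbrella(1)[OF w c pos] by simp
    have coc: "\<Gamma> x z = \<Gamma> x y * \<Gamma> y z" if "accessible w x y" "accessible w y z" for x y z
      using c that by (auto simp: cocycle_measure_for_def cocycle_def)
    have "\<Gamma> x0 x0 = \<Gamma> x0 x0 * \<Gamma> x0 x0" by (rule coc) (rule accessible_refl)+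
    then have one: "\<Gamma> x0 x0 = 1" using pos[OF accessible_refl[of w x0]] by simp
    have K: "\<Gamma> x0 \<in> ?K"
      using complete_cocycle_sum[OF w c pos x0] pos[OF x0] one \<rho>
      by (simp add: positive_eigenfunctions_def eigenfunction_def)
    have "\<mu> = m (\<Gamma> x0)"
    proof (rule cocycle_measure_unique)
      show "cocycle_measure_for w ?r \<Gamma> \<mu>" using c \<rho> by simp
      show "cocycle_measure_for w ?r (\<lambda>x y. \<Gamma> x0 y / \<Gamma> x0 x) (m (\<Gamma> x0))" by (rule m[OF K])
      show "\<Gamma> x y = \<Gamma> x0 y / \<Gamma> x0 x" if "accessible w x y" for x y
        using coc[OF x0 that] pos[OF x0[of x]] by simp
    qed
    then show "\<mu> \<in> m ` ?K" using K by blast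
  qed
  then show ?thesis by blast
qed

lemma normalised_final_eigenfunction:
  fixes w :: "'v::finite \<Rightarrow> 'v \<Rightarrow> real"
  assumes w: "weighted_digraph w" and u: "umbrella_digraph w" and x0: "\<And>y. accessible w x0 y"
    and D: "D \<in> final_classes w"
  shows "\<exists>h. (\<forall>x. 0 \<le> h x) \<and> eigenfunction w (digraph_radius w) h \<and> (\<forall>x\<in>D. 0 < h x) \<and>
    (\<forall>x. x \<notin> transient w \<longrightarrow> x \<notin> D \<longrightarrow> h x = 0) \<and> h x0 = 1"
proof -
  have r: "0 < digraph_radius w" using u by (simp add: umbrella_digraph_def)
  obtain h where h: "\<And>x. 0 \<le> h x" "eigenfunction w (digraph_radius w) h"
    "\<And>x. x \<in> D \<Longrightarrow> 0 < h x" "\<And>x. x \<notin> transient w \<Longrightarrow> x \<notin> D \<Longrightarrow> h x = 0"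
    by (rule umbrella_final_eigenfunction[OF w u D]) (rule that)
  have "D \<in> access_classes w" using D by (simp add: final_classes_def)
  then obtain y where "y \<in> D" using access_class_nonempty by blast
  then have pos: "0 < h x0" using eigenfunction_pos_propagates[OF w r h(1,2) x0] h(3) by blast
  \<comment> \<open>A sum over one index, so that scaling becomes an instance of
    \<open>eigenfunction_sum\<close>.\<close>
  have "eigenfunction w (digraph_radius w) (\<lambda>x. \<Sum>i\<in>{()}. (1 / h x0) * h x)"
    by (rule eigenfunction_sum) (rule h(2))
  then have "eigenfunction w (digraph_radius w) (\<lambda>x. h x / h x0)" by simp
  then show ?thesis using h pos by (intro exI[of _ "\<lambda>x. h x / h x0"]) simp
qed

text \<open>Both functions restrict to positive eigenfunctions of the block of D for the same
  eigenvalue, so rigidity of the comparison makes them proportional.\<close>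

lemma eigenfunction_multiple_on_final:
  fixes w :: "'v::finite \<Rightarrow> 'v \<Rightarrow> real"
  assumes w: "weighted_digraph w" and D: "D \<in> final_classes w"
    and g: "\<And>x. x \<in> D \<Longrightarrow> 0 < g x" "eigenfunction w r g"
    and h: "\<And>x. x \<in> D \<Longrightarrow> 0 < h x" "eigenfunction w r h"
  shows "\<exists>c>0. \<forall>x\<in>D. g x = c * h x"
proof -
  have Da: "D \<in> access_classes w" using D by (simp add: final_classes_def)
  obtain y where y: "y \<in> D" using access_class_nonempty[OF Da] by blast
  have eq: "restricted_sum w D f x = r * f x" if "eigenfunction w r f" "x \<in> D" for f x
    using restricted_sum_final[OF w D that(2), of f] that(1) by (simp add: eigenfunction_def)
  show ?thesis
  proof (rule comparison_rigid[OF w Da, of h r g y])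
    show "restricted_sum w D h x \<le> r * h x" if "x \<in> D" for x using eq[OF h(2) that] by simp
    show "r * g x \<le> restricted_sum w D g x" if "x \<in> D" for x using eq[OF g(2) that] by simp
    show "g y \<noteq> 0" using g(1)[OF y] by simp
    show "0 \<le> g x" if "x \<in> D" for x using g(1)[OF that] by simp
    fix c :: real assume "0 < c" "\<And>x. x \<in> D \<Longrightarrow> g x = c * h x"
    then show ?thesis by blast
  qed (use h y in auto)
qed

lemma positive_eigenfunctions_bij:
  fixes w :: "'v::finite \<Rightarrow> 'v \<Rightarrow> real"
  assumes w: "weighted_digraph w" and u: "umbrella_digraph w" and x0: "\<And>y. accessible w x0 y"
  shows "\<exists>f. bij_betw f (open_standard_simplex (card (basic_classes w) - 1)) (positive_eigenfunctions w x0)"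
proof -
  let ?r = "digraph_radius w" and ?K = "positive_eigenfunctions w x0" and ?F = "final_classes w"
  define n where "n = card (basic_classes w) - 1"
  have r: "0 < ?r" and bf: "basic_classes w = ?F" using u by (auto simp: umbrella_digraph_def)
  obtain D0 where "D0 \<in> ?F" using final_class_accessible by metis
  then have "0 < card ?F" by (auto simp: card_gt_0_iff)
  \<comment> \<open>Some final class exists, so the truncated subtraction in n loses
    nothing.\<close>
  then have "{..<card ?F} = {..n}" using bf by (auto simp: n_def)
  moreover obtain e where "bij_betw e {0..<card ?F} ?F" using ex_bij_betw_nat_finite[of ?F] by auto
  ultimately have e: "bij_betw e {..n} ?F" by (simp add: atLeast0LessThan)
  have eF: "e i \<in> ?F" if "i \<le> n" for i using e that by (auto simp: bij_betw_def)
  have ne: "\<exists>x. x \<in> e i" if "i \<le> n" for i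
  proof -
    have "e i \<in> access_classes w" using eF[OF that] by (simp add: final_classes_def)
    then show ?thesis using access_class_nonempty by blast
  qed
  have "\<forall>D\<in>?F. \<exists>h. (\<forall>x. 0 \<le> h x) \<and> eigenfunction w ?r h \<and> (\<forall>x\<in>D. 0 < h x) \<and>
    (\<forall>x. x \<notin> transient w \<longrightarrow> x \<notin> D \<longrightarrow> h x = 0) \<and> h x0 = 1"
    using normalised_final_eigenfunction[OF w u x0] by blast
  from bchoice[OF this] obtain H' where H': "\<forall>D\<in>?F. (\<forall>x. 0 \<le> H' D x) \<and> eigenfunction w ?r (H' D) \<and>
      (\<forall>x\<in>D. 0 < H' D x) \<and> (\<forall>x. x \<notin> transient w \<longrightarrow> x \<notin> D \<longrightarrow> H' D x = 0) \<and> H' D x0 = 1" ..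
  define H where "H i = H' (e i)" for i
  have H0: "0 \<le> H i x" and Heig: "eigenfunction w ?r (H i)" and Hx0: "H i x0 = 1" if "i \<le> n" for i x
    using H' eF[OF that] by (auto simp: H_def)
  have Hpos: "0 < H i x" if "i \<le> n" "x \<in> e i" for i x
    using H' eF[OF that(1)] that(2) by (auto simp: H_def)
  have Hoff: "H i x = 0" if "i \<le> n" "x \<notin> transient w" "x \<notin> e i" for i x
    using H' eF[OF that(1)] that by (auto simp: H_def)
  define G where "G t x = (\<Sum>i\<le>n. t i * H i x)" for t :: "nat \<Rightarrow> real" and x
  have Geig: "eigenfunction w ?r (G t)" for t
    unfolding G_def by (rule eigenfunction_sum) (simp add: Heig)
  \<comment> \<open>Normalisation at x0 turns the condition h(x0) = 1 into the equation of the
    simplex.\<close>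
  have Gx0: "G t x0 = (\<Sum>i\<le>n. t i)" for t unfolding G_def using Hx0 by simp
  \<comment> \<open>On a final class only its own basis function survives, so each coordinate can be
    read off there.\<close>
  have Gon: "G t x = t j * H j x" if j: "j \<le> n" and x: "x \<in> e j" for t j x
  proof -
    have "t i * H i x = (if i = j then t j * H j x else 0)" if i: "i \<le> n" for i
    proof (cases "i = j")
      case False
      then have "e i \<noteq> e j" using e i j by (auto simp: bij_betw_def inj_on_def)
      then have "x \<notin> e i" using final_classes_disjoint[OF eF[OF i] eF[OF j] _ x] by blast
      then show ?thesis using Hoff[OF i not_transientI[OF eF[OF j] x]] False by simp
    qed simp
    then have "G t x = (\<Sum>i\<le>n. if i = j then t j * H j x else 0)"
      unfolding G_def by (intro sum.cong) auto
    then show ?thesis using j by simp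
  qed
  have off: "\<exists>j\<le>n. x \<in> e j" if nt: "x \<notin> transient w" for x
  proof -
    obtain D where D: "D \<in> ?F" "x \<in> D" using not_transientE[OF nt] .
    then show ?thesis using e by (auto simp: bij_betw_def)
  qed
  have "bij_betw G (open_standard_simplex n) ?K"
    unfolding bij_betw_def
  proof (intro conjI inj_onI equalityI subsetI)
    fix s t assume s: "s \<in> open_standard_simplex n" and t: "t \<in> open_standard_simplex n" and eq: "G s = G t"
    show "s = t"
    proof
      fix i
      show "s i = t i"
      proof (cases "i \<le> n")
        case True
        obtain x where x: "x \<in> e i" using ne[OF True] by blast
        have "s i * H i x = t i * H i x" using Gon[OF True x] eq by metis
        then show ?thesis using Hpos[OF True x] by simp
      qed (use s t in \<open>simp add: open_standard_simplex_def standard_simplex_def\<close>)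
    qed
  next
    fix h assume "h \<in> G ` open_standard_simplex n"
    then obtain t where t: "t \<in> open_standard_simplex n" "h = G t" by blast
    then have tpos: "\<And>i. i \<le> n \<Longrightarrow> 0 < t i" and tsum: "(\<Sum>i\<le>n. t i) = 1"
      by (auto simp: open_standard_simplex_def standard_simplex_def)
    have "0 \<le> G t x" for x unfolding G_def using tpos H0 by (intro sum_nonneg) (simp add: less_imp_le)
    moreover have "0 < G t x" if nt: "x \<notin> transient w" for x
    proof -
      obtain j where "j \<le> n" "x \<in> e j" using off[OF nt] by blast
      then show ?thesis using Gon[of j x t] tpos[of j] Hpos[of j x] by simp
    qed
    ultimately have "0 < G t x" for x using eigenfunction_pos[OF w r _ Geig] by blast
    then show "h \<in> ?K" using Geig Gx0 tsum t by (simp add: positive_eigenfunctions_def)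
  next
    fix h assume hK: "h \<in> ?K"
    then have hpos: "\<And>x. 0 < h x" and heig: "eigenfunction w ?r h" and hx0: "h x0 = 1"
      by (auto simp: positive_eigenfunctions_def)
    have "\<forall>i\<in>{..n}. \<exists>c>0. \<forall>x\<in>e i. h x = c * H i x"
    proof
      fix i assume "i \<in> {..n}"
      then have i: "i \<le> n" by simp
      show "\<exists>c>0. \<forall>x\<in>e i. h x = c * H i x"
        by (rule eigenfunction_multiple_on_final[OF w eF[OF i] hpos heig Hpos[OF i] Heig[OF i]])
    qed
    from bchoice[OF this] obtain c where c: "\<And>i. i \<le> n \<Longrightarrow> 0 < c i"
      "\<And>i x. i \<le> n \<Longrightarrow> x \<in> e i \<Longrightarrow> h x = c i * H i x" by auto
    \<comment> \<open>Points of the standard simplex vanish beyond coordinate n, hence the default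
      0.\<close>
    define t where "t i = (if i \<le> n then c i else 0)" for i
    have "G t = h"
    proof (rule umbrella_eigenfunction_unique[OF w u Geig heig])
      fix x assume nt: "x \<notin> transient w"
      obtain j where "j \<le> n" "x \<in> e j" using off[OF nt] by blast
      then show "G t x = h x" using Gon[of j x t] c(2)[of j x] by (simp add: t_def)
    qed
    moreover have "t \<in> open_standard_simplex n"
    proof -
      have sum: "(\<Sum>i\<le>n. t i) = 1" using Gx0[of t] \<open>G t = h\<close> hx0 by simp
      have t0: "0 \<le> t i" for i using c(1)[of i] by (auto simp: t_def less_imp_le)
      have "t i \<le> 1" for i
      proof (cases "i \<le> n")
        case True
        then have "t i \<le> (\<Sum>i\<le>n. t i)" using t0 by (intro member_le_sum) auto
        then show ?thesis using sum by simp
      qed (simp add: t_def)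
      then show ?thesis using t0 sum c(1) by (simp add: open_standard_simplex_def standard_simplex_def t_def)
    qed
    ultimately show "h \<in> G ` open_standard_simplex n" by blast
  qed
  then show ?thesis unfolding n_def by blast
qed

theorem theorem3p8:
  fixes w :: "'v::finite \<Rightarrow> 'v \<Rightarrow> real"
  assumes "weighted_digraph w"
  shows "(umbrella_digraph w \<longleftrightarrow> (\<exists>\<mu>. complete_cocycle_measure w \<mu>)) \<and>
    (umbrella_digraph w \<and> (\<exists>x. \<forall>y. accessible w x y) \<longrightarrow>
      (\<exists>f. bij_betw f (open_standard_simplex (card (basic_classes w) - 1))
             {\<mu>. complete_cocycle_measure w \<mu>}))"
proof (intro conjI iffI impI)
  assume u: "umbrella_digraph w"
  then have r: "0 < digraph_radius w" by (simp add: umbrella_digraph_def)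
  have "\<forall>D\<in>final_classes w. \<exists>v. (\<forall>x\<in>D. 0 < v x) \<and> (\<forall>x\<in>D. restricted_sum w D v x = digraph_radius w * v x)"
  proof
    fix D assume D: "D \<in> final_classes w"
    show "\<exists>v. (\<forall>x\<in>D. 0 < v x) \<and> (\<forall>x\<in>D. restricted_sum w D v x = digraph_radius w * v x)"
      by (rule umbrella_final_perron[OF assms u D]) blast
  qed
  from bchoice[OF this] obtain V where V: "\<And>D x. D \<in> final_classes w \<Longrightarrow> x \<in> D \<Longrightarrow> 0 < V D x"
    "\<And>D x. D \<in> final_classes w \<Longrightarrow> x \<in> D \<Longrightarrow> restricted_sum w D (V D) x = digraph_radius w * V D x"
    by auto
  \<comment> \<open>Glues the Perron vectors of the final classes; its values at transient vertices
    are arbitrary and get replaced by the extension h.\<close>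
  define b where "b x = V (access_class_of w x) x" for x
  have class_eq: "access_class_of w x = D" if "D \<in> final_classes w" "x \<in> D" for D x
    using access_class_of_eqI[of D w x] that by (simp add: final_classes_def)
  have bpos: "0 < b x" if "x \<notin> transient w" for x
    using that V(1)[of "access_class_of w x" x] by (simp add: b_def transient_def)
  have b: "restricted_sum w D b x = digraph_radius w * b x" if D: "D \<in> final_classes w" "x \<in> D" for D x
  proof -
    have "restricted_sum w D b x = restricted_sum w D (V D) x"
      unfolding restricted_sum_def b_def using class_eq[OF D(1)] by (intro sum.cong) auto
    then show ?thesis using V(2)[OF D] class_eq[OF D] by (simp add: b_def)
  qed
  obtain h where h: "\<And>x. 0 \<le> h x" "\<And>x. x \<notin> transient w \<Longrightarrow> h x = b x"
    "eigenfunction w (digraph_radius w) h"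
    by (rule umbrella_eigenfunction_extension[where b = b, OF assms u less_imp_le[OF bpos]])
      (assumption, erule (1) b, rule that)
  have pos: "0 < h x" for x
    by (rule eigenfunction_pos[OF assms r h(1,3)]) (use h(2) bpos in simp)
  obtain \<mu> where "cocycle_measure_for w (digraph_radius w) (\<lambda>x y. h y / h x) \<mu>"
    using eigenfunction_cocycle_measure[OF assms r pos h(3)] by blast
  moreover have "\<forall>x y. accessible w x y \<longrightarrow> 0 < h y / h x" using pos by simp
  ultimately show "\<exists>\<mu>. complete_cocycle_measure w \<mu>"
    unfolding complete_cocycle_measure_def by blast
next
  assume "\<exists>\<mu>. complete_cocycle_measure w \<mu>"
  then obtain \<mu> r \<Gamma> where c: "cocycle_measure_for w r \<Gamma> \<mu>" and pos: "\<And>x y. accessible w x y \<Longrightarrow> 0 < \<Gamma> x y"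
    by (auto simp: complete_cocycle_measure_def)
  show "umbrella_digraph w" by (rule complete_cocycle_umbrella(2)[OF assms c pos])
next
  assume "umbrella_digraph w \<and> (\<exists>x. \<forall>y. accessible w x y)"
  then obtain x0 where u: "umbrella_digraph w" and x0: "\<And>y. accessible w x0 y" by blast
  obtain f m where "bij_betw f (open_standard_simplex (card (basic_classes w) - 1)) (positive_eigenfunctions w x0)"
    "bij_betw m (positive_eigenfunctions w x0) {\<mu>. complete_cocycle_measure w \<mu>}"
    using positive_eigenfunctions_bij[OF assms u x0] complete_cocycle_measures_bij[OF assms u x0] by blast
  then have "bij_betw (m \<circ> f) (open_standard_simplex (card (basic_classes w) - 1))
             {\<mu>. complete_cocycle_measure w \<mu>}" by (rule bij_betw_trans)
  then show "\<exists>f. bij_betw f (open_standard_simplex (card (basic_classes w) - 1))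
             {\<mu>. complete_cocycle_measure w \<mu>}" by blast
qed

end
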